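(* When $n_{\mathrm{per}}=1$, there exists a random variable $Z_\infty$ with values in $[0,1]$ such that $\mathbf{Z}_n\to Z_\infty\mathbf{1}$ almost surely if and only if $\sum_n r_n=+\infty$. When $n_{\mathrm{per}}\ge2$, there exists a random variable $Z_\infty$ with values in $[0,1]$ such that $\mathbf{Z}_n\to Z_\infty\mathbf{1}$ almost surely if and only if $\sum_n r_n(1-r_n)=+\infty$.
   Context: Let $N\ge 2$, $V=\{1,\dots,N\}$, and let $W=[w_{l_1,l_2}]_{l_1,l_2\in V}$ be an irreducible real matrix with non-negative entries such that $W^\top\mathbf{1}=\mathbf{1}$, where $\mathbf{1}$ is the all-ones vector ($\mathbf{0}$ is the zero vector). Let $(r_n)_{n\ge0}$ be a deterministic sequence with $0<r_n<1$. Let $\mathbf{Z}_0=[Z_{0,1},\dots,Z_{0,N}]^\top$ be a random vector with values in $[0,1]^N$ such that $P(\mathbf{Z}_0=\mathbf{0})+P(\mathbf{Z}_0=\mathbf{1})<1$ and, for $n\ge 0$, let $\mathcal{F}_n=\sigma(Z_{0,l}:l\in V)\vee\sigma(X_{k,l}:1\le k\le n,\,l\in V)$. Given $\mathcal{F}_n$, the random variables $X_{n+1,l}$, $l\in V$, are $\{0,1\}$-valued and conditionally independent with $P(X_{n+1,l}=1\mid\mathcal{F}_n)=\sum_{l_1=1}^N w_{l_1,l}Z_{n,l_1}=[W^\top\mathbf{Z}_n]_l$, and $\mathbf{Z}_{n+1}=(1-r_n)\mathbf{Z}_n+r_n\mathbf{X}_{n+1}$, where $\mathbf{X}_{n}=[X_{n,1},\dots,X_{n,N}]^\top$,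 $\mathbf{Z}_{n}=[Z_{n,1},\dots,Z_{n,N}]^\top$. $n_{\mathrm{per}}\ge1$ denotes the period of the irreducible matrix $W^\top$, i.e. $\gcd\{k\ge1:[(W^\top)^k]_{l,l}>0\}$ (independent of $l$). *)

theory Defs
  imports "HOL-Probability.Probability"
begin

text \<open>
  Powers with respect to the matrix product; the type class power \<open>A ^ k\<close> on \<open>real ^ 'n ^ 'n\<close>
  is the entrywise one.
\<close>

primrec matpow :: "real ^ 'n ^ 'n \<Rightarrow> nat \<Rightarrow> real ^ 'n ^ 'n" where
  "matpow A 0 = mat 1"
| "matpow A (Suc k) = A ** matpow A k"

definition irreducible_mat :: "real ^ 'n ^ 'n \<Rightarrow> bool" where
  "irreducible_mat A \<longleftrightarrow> (\<forall>i j. \<exists>k\<ge>1. matpow A k $ i $ j > 0)"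

definition return_times :: "real ^ 'n ^ 'n \<Rightarrow> 'n \<Rightarrow> nat set" where
  "return_times A l = {k. k \<ge> 1 \<and> matpow A k $ l $ l > 0}"

text \<open>
  The common value of the gcd over all indices, which exists for irreducible non-negative
  matrices by \<open>mat_period_eq\<close> below.
\<close>

definition mat_period :: "real ^ 'n ^ 'n \<Rightarrow> nat" where
  "mat_period A = (THE d. \<forall>l. Gcd (return_times A l) = d)"

lemma matpow_add: "matpow A (m + n) = matpow A m ** matpow A n"
  by (induction m) (simp_all add: matrix_mul_assoc)

lemma matpow_nonneg:
  assumes "\<And>i j. A $ i $ j \<ge> 0"
  shows "matpow A k $ i $ j \<ge> 0"
  using assms
  by (induction k arbitrary: i j) (auto simp: mat_def matrix_matrix_mult_def intro!: sum_nonneg)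

lemma matpow_add_pos:
  assumes "\<And>i j. A $ i $ j \<ge> 0" "matpow A m $ i $ k > 0" "matpow A n $ k $ j > 0"
  shows "matpow A (m + n) $ i $ j > 0"
proof -
  have "matpow A (m + n) $ i $ j = (\<Sum>l\<in>UNIV. matpow A m $ i $ l * matpow A n $ l $ j)"
    by (simp add: matpow_add matrix_matrix_mult_def)
  also have "\<dots> > 0"
    by (rule sum_pos2[of _ k]) (use assms in \<open>auto intro!: mult_nonneg_nonneg matpow_nonneg\<close>)
  finally show ?thesis .
qed

lemma Gcd_return_times_dvd:
  assumes "\<And>i j. A $ i $ j \<ge> 0" "irreducible_mat A"
  shows "Gcd (return_times A i) dvd Gcd (return_times A j)"
proof (rule Gcd_greatest)
  fix k assume k: "k \<in> return_times A j"
  obtain a b where a: "a \<ge> 1" "matpow A a $ i $ j > 0" and b: "b \<ge> 1" "matpow A b $ j $ i > 0"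
    using assms(2) unfolding irreducible_mat_def by meson
  have "matpow A (a + b) $ i $ i > 0"
    using matpow_add_pos[OF assms(1) a(2) b(2)] .
  then have 1: "Gcd (return_times A i) dvd a + b"
    using a by (intro Gcd_dvd) (auto simp: return_times_def)
  have "matpow A (a + k) $ i $ j > 0"
    using matpow_add_pos[OF assms(1) a(2)] k by (auto simp: return_times_def)
  then have "matpow A (a + k + b) $ i $ i > 0"
    using matpow_add_pos[OF assms(1) _ b(2)] by blast
  then have "Gcd (return_times A i) dvd a + k + b"
    using a by (intro Gcd_dvd) (auto simp: return_times_def)
  then have "Gcd (return_times A i) dvd k + (a + b)"
    by (simp add: ac_simps)
  with 1 show "Gcd (return_times A i) dvd k"
    using dvd_add_left_iff by blast
qed

lemma mat_period_eq:
  assumes "\<And>i j. A $ i $ j \<ge> 0" "irreducible_mat A"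
  shows "mat_period A = Gcd (return_times A l)"
  unfolding mat_period_def
proof (rule the_equality)
  show "\<forall>l'. Gcd (return_times A l') = Gcd (return_times A l)"
    using Gcd_return_times_dvd[OF assms] by (simp add: dvd_antisym)
qed auto

definition cond_prob_sigma :: "'a measure \<Rightarrow> 'a measure \<Rightarrow> 'a set \<Rightarrow> 'a \<Rightarrow> real" where
  "cond_prob_sigma M F A = real_cond_exp M F (indicator A)"

definition cond_indep_vars ::
    "'a measure \<Rightarrow> 'a measure \<Rightarrow> ('i \<Rightarrow> 'b measure) \<Rightarrow> ('i \<Rightarrow> 'a \<Rightarrow> 'b) \<Rightarrow> 'i set \<Rightarrow> bool" where
  "cond_indep_vars M F M' X I \<longleftrightarrow>
     (\<forall>i\<in>I. X i \<in> measurable M (M' i)) \<and>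
     (\<forall>J\<subseteq>I. J \<noteq> {} \<longrightarrow> finite J \<longrightarrow> (\<forall>A\<in>(\<Pi> j\<in>J. sets (M' j)).
        AE \<omega> in M. cond_prob_sigma M F (\<Inter>j\<in>J. X j -` A j \<inter> space M) \<omega> =
                   (\<Prod>j\<in>J. cond_prob_sigma M F (X j -` A j \<inter> space M) \<omega>)))"

definition history ::
    "'a measure \<Rightarrow> ('a \<Rightarrow> real ^ 'n) \<Rightarrow> (nat \<Rightarrow> 'a \<Rightarrow> real ^ 'n) \<Rightarrow> nat \<Rightarrow> 'a measure" where
  "history M Z0 X n = sigma (space M)
     ({(\<lambda>\<omega>. Z0 \<omega> $ l) -` B \<inter> space M | l B. B \<in> sets borel} \<union>
      {(\<lambda>\<omega>. X k \<omega> $ l) -` B \<inter> space M | k l B. k \<in> {1..n} \<and> B \<in> sets borel})"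

definition ae_synchronizes :: "'a measure \<Rightarrow> (nat \<Rightarrow> 'a \<Rightarrow> real ^ 'n) \<Rightarrow> bool" where
  "ae_synchronizes M Z \<longleftrightarrow>
     (\<exists>Zinf. Zinf \<in> borel_measurable M \<and> (\<forall>\<omega>\<in>space M. Zinf \<omega> \<in> {0..1}) \<and>
        (AE \<omega> in M. (\<lambda>n. Z n \<omega>) \<longlonglongrightarrow> Zinf \<omega> *\<^sub>R 1))"

end

theory Submission
  imports Defs
begin

text \<open>
  Write \<open>P\<close> for the transposed weight matrix, \<open>\<pi>\<close> for its positive stationary distribution, and
  \<open>drift r x = (1 - r) x + r P x\<close>, the conditional mean of the next state. For a linear functional \<open>f\<close>, the
  second moment of \<open>f (Z (n + 1))\<close> is that of \<open>f (drift (r n) (Z n))\<close> plus a noise term.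

  Since \<open>\<pi> \<bullet> Z n\<close> is a bounded martingale, the total noise is finite. Hence the mean \<open>\<pi>\<close>-weighted distance
  of \<open>Z n\<close> to the constants tends to 0 as soon as products of drifts kill the vectors of \<open>\<pi>\<close>-mean zero, and a
  maximal inequality for \<open>Z k - (\<pi> \<bullet> Z n) 1\<close>, \<open>k \<ge> n\<close>, upgrades this to almost sure convergence. The
  products vanish by the spectral gap of \<open>P\<close> if \<open>\<Sum> r (1 - r) = \<infinity>\<close>; otherwise, if \<open>\<Sum> r = \<infinity>\<close>, then \<open>r\<close> tends
  to 1 along a subsequence, so powers of \<open>P\<close> appear, which contract if \<open>P\<close> is aperiodic.

  Conversely, some quadratic form vanishing on the constants loses at most the factor \<open>1 - 4 r (1 - r)\<close> in each
  step: the variance under \<open>\<pi>\<close> once \<open>r \<le> 1/2\<close>, and for a periodic \<open>P\<close> the square sum of the differences of the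
  masses of consecutive cyclic classes. Its expectation is eventually positive because the initial state is not
  almost surely \<open>0\<close> or \<open>1\<close>, so it stays bounded away from 0 if \<open>\<Sum> r (1 - r) < \<infinity>\<close>.
\<close>

section \<open>Irreducible stochastic matrices\<close>

lemma matpow_transpose: "matpow (transpose A) k = transpose (matpow A k)"
proof (induction k)
  case (Suc k)
  have "matpow A (Suc k) = matpow A k ** A"
    using matpow_add[of A k 1] by simp
  then show ?case
    by (simp add: Suc matrix_transpose_mul)
qed (simp add: transpose_mat)

lemma irreducible_mat_transpose: "irreducible_mat (transpose A) \<longleftrightarrow> irreducible_mat A"
  unfolding irreducible_mat_def matpow_transpose by (auto simp: transpose_def)

text \<open>The least positive difference \<open>d\<close> of two elements of \<open>T\<close>
  divides all of \<open>T\<close>, so \<open>d = 1\<close>. Two consecutive elements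
  \<open>n\<close> and \<open>n + 1\<close> then generate every number from \<open>n * n\<close>
  on.\<close>

lemma additive_gcd_1_eventually:
  fixes S :: "nat set"
  assumes add: "\<And>a b. a \<in> S \<Longrightarrow> b \<in> S \<Longrightarrow> a + b \<in> S" and gcd: "Gcd S = 1"
  shows "\<exists>n0. \<forall>n\<ge>n0. n \<in> S"
proof -
  define T where "T = insert 0 S"
  have T0: "0 \<in> T" and Tadd: "a + b \<in> T" if "a \<in> T" "b \<in> T" for a b
    using that add by (auto simp: T_def)
  have Tmult: "q * a \<in> T" if "a \<in> T" for q a
    by (induction q) (use that T0 Tadd in auto)
  have "Gcd T = 1" using gcd by (simp add: T_def)
  define D where "D = (\<lambda>d. d > 0 \<and> (\<exists>n\<in>T. n + d \<in> T))"
  have "\<exists>s\<in>T. s > 0"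
  proof (rule ccontr)
    assume "\<not> ?thesis"
    then have "Gcd T = 0" by (auto simp: Gcd_0_iff)
    with \<open>Gcd T = 1\<close> show False by simp
  qed
  then have exD: "\<exists>d. D d" using T0 by (force simp: D_def)
  define d where "d = (LEAST d. D d)"
  have "D d" unfolding d_def using exD by (rule LeastI_ex)
  then obtain n where n: "n \<in> T" "n + d \<in> T" and d0: "d > 0" by (auto simp: D_def)
  have "d dvd s" if s: "s \<in> T" for s
  proof (rule ccontr)
    assume nd: "\<not> d dvd s"
    define q where "q = s div d"
    define t where "t = s mod d"
    have t: "t > 0" "t < d" "s = q * d + t"
      using nd d0 by (auto simp: t_def q_def dvd_eq_mod_eq_0)
    \<comment> \<open>Both \<open>q * n + s\<close> and \<open>q * (n + d)\<close> lie in
      \<open>T\<close> and differ by the remainder \<open>t < d\<close>, against the minimality of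
      \<open>d\<close>.\<close>
    have "q * (n + d) + t = q * n + s" using t by (simp add: algebra_simps)
    moreover have "q * n + s \<in> T" using Tadd Tmult n s by blast
    ultimately have "D t" unfolding D_def using t(1) Tmult[OF n(2), of q] by metis
    then have "d \<le> t" unfolding d_def by (rule Least_le)
    with t show False by simp
  qed
  then have "d dvd Gcd T" by (intro Gcd_greatest)
  with \<open>Gcd T = 1\<close> have "d = 1" by simp
  have "N \<in> T" if N: "N \<ge> n * n" for N
  proof (cases "n = 0")
    case True
    then show ?thesis using n \<open>d = 1\<close> Tmult[of 1 N] by simp
  next
    case False
    define a where "a = N div n"
    define b where "b = N mod n"
    have "b < n" "N = a * n + b" using False by (auto simp: a_def b_def)
    \<comment> \<open>For \<open>N \<ge> n * n\<close> the quotient is at least \<open>n\<close> and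
      so exceeds the remainder \<open>b\<close>; hence \<open>a - b\<close> is a genuine difference
      of naturals, and \<open>b\<close> copies of \<open>n\<close> can be traded for
      \<open>n + 1\<close>.\<close>
    moreover have "n \<le> a" unfolding a_def using N False
      by (metis div_le_mono nonzero_mult_div_cancel_right)
    ultimately have "N = (a - b) * n + b * (n + d)"
      using \<open>d = 1\<close> by (auto simp: algebra_simps diff_mult_distrib2 mult.commute intro!: le_add_diff_inverse2 [symmetric])
    then show ?thesis using Tadd Tmult n by metis
  qed
  \<comment> \<open>The successor excludes \<open>N = 0\<close>, the one element that
    \<open>T\<close> may have beyond \<open>S\<close>.\<close>
  then have "N \<in> S" if "N \<ge> Suc (n * n)" for N
    using that by (auto simp: T_def dest: Suc_leD)
  then show ?thesis by blast
qed

text \<open>The vector \<open>1\<close> lies in the kernel of \<open>P - mat 1\<close>, and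
  transposing preserves the determinant, so the transpose is singular too.\<close>

lemma stochastic_fixed_ker:
  fixes P :: "real ^ 'n ^ 'n"
  assumes "P *v 1 = 1"
  shows "\<exists>v. v \<noteq> 0 \<and> v v* P = v"
proof -
  have ker: "det A = 0 \<longleftrightarrow> (\<exists>x. x \<noteq> 0 \<and> A *v x = 0)" for A :: "real ^ 'n ^ 'n"
    using invertible_det_nz[of A] matrix_left_invertible_ker[of A] invertible_left_inverse[of A] by blast
  have "(P - mat 1) *v 1 = 0" using assms by (simp add: matrix_vector_mult_diff_rdistrib)
  moreover have "(1 :: real ^ 'n) \<noteq> 0" by (simp add: vec_eq_iff)
  ultimately have "det (P - mat 1) = 0" using ker by blast
  then have "det (transpose (P - mat 1)) = 0" by (simp add: det_transpose)
  then obtain v where v: "v \<noteq> 0" "transpose (P - mat 1) *v v = 0"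
    using ker by blast
  have "transpose (P - mat 1) = transpose P - mat 1"
    by (auto simp: vec_eq_iff transpose_def mat_def)
  then have "v v* P = v"
    using v(2) by (simp add: matrix_vector_mult_diff_rdistrib)
  with v(1) show ?thesis by blast
qed

lemma row_sum_1:
  fixes P :: "real ^ 'n ^ 'n"
  assumes "P *v 1 = 1"
  shows "(\<Sum>j\<in>UNIV. P $ i $ j) = 1"
  using assms by (simp add: vec_eq_iff matrix_vector_mult_def)

lemma vector_matpow_fixed: "v v* P = v \<Longrightarrow> v v* matpow P k = v"
  by (induction k) (simp_all flip: vector_matrix_mul_assoc)

lemma matpow_vector_fixed: "P *v x = x \<Longrightarrow> matpow P k *v x = x"
  by (induction k) (simp_all flip: matrix_vector_mul_assoc)

text \<open>For a left fixed vector \<open>v\<close>, the triangle inequality gives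
  \<open>\<bar>v\<bar> \<le> \<bar>v\<bar> P\<close> entrywise. Rows of \<open>P\<close> sum to 1,
  so both sides have the same total and agree. Irreducibility spreads one positive entry to all
  indices; it remains to normalize.\<close>

lemma ex_stationary_distribution:
  fixes P :: "real ^ 'n ^ 'n"
  assumes nn: "\<And>i j. P $ i $ j \<ge> 0" and irr: "irreducible_mat P" and one: "P *v 1 = 1"
  shows "\<exists>\<pi>. (\<forall>i. \<pi> $ i > 0) \<and> (\<Sum>i\<in>UNIV. \<pi> $ i) = 1 \<and> \<pi> v* P = \<pi>"
proof -
  obtain v where v: "v \<noteq> 0" "v v* P = v" using stochastic_fixed_ker[OF one] by blast
  define w where "w = (\<chi> i. \<bar>v $ i\<bar>)"
  have vP: "(\<Sum>i\<in>UNIV. v $ i * P $ i $ j) = v $ j" for j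
    using v(2) by (simp add: vec_eq_iff vector_matrix_mult_def)
  have le: "w $ j \<le> (w v* P) $ j" for j
  proof -
    have "w $ j = \<bar>\<Sum>i\<in>UNIV. v $ i * P $ i $ j\<bar>" by (simp add: w_def vP)
    also have "\<dots> \<le> (\<Sum>i\<in>UNIV. \<bar>v $ i * P $ i $ j\<bar>)" by (rule sum_abs)
    also have "\<dots> = (w v* P) $ j" by (simp add: w_def vector_matrix_mult_def abs_mult nn)
    finally show ?thesis .
  qed
  have "(\<Sum>j\<in>UNIV. (w v* P) $ j) = (\<Sum>i\<in>UNIV. \<Sum>j\<in>UNIV. w $ i * P $ i $ j)"
    unfolding vector_matrix_mult_def by (simp, rule sum.swap)
  also have "\<dots> = (\<Sum>i\<in>UNIV. w $ i)"
    by (simp add: row_sum_1[OF one] flip: sum_distrib_left)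
  finally have eq: "(\<Sum>j\<in>UNIV. (w v* P) $ j - w $ j) = 0" by (simp add: sum_subtractf)
  have "(w v* P) $ j - w $ j = 0" for j
    using eq le by (subst (asm) sum_nonneg_eq_0_iff) auto
  then have wP: "w v* P = w" by (simp add: vec_eq_iff)
  obtain i0 where i0: "w $ i0 > 0" using v(1) by (auto simp: vec_eq_iff w_def)
  have wnn: "w $ i \<ge> 0" for i by (simp add: w_def)
  have pos: "w $ j > 0" for j
  proof -
    obtain k where k: "matpow P k $ i0 $ j > 0" using irr by (auto simp: irreducible_mat_def)
    have "w $ j = (\<Sum>i\<in>UNIV. w $ i * matpow P k $ i $ j)"
      using vector_matpow_fixed[OF wP, of k] by (simp add: vec_eq_iff vector_matrix_mult_def)
    also have "\<dots> > 0"
      by (rule sum_pos2[of _ i0]) (use k i0 matpow_nonneg[OF nn] wnn in \<open>auto\<close>)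
    finally show ?thesis .
  qed
  define s where "s = (\<Sum>i\<in>UNIV. w $ i)"
  have s: "s > 0" unfolding s_def using pos by (intro sum_pos) auto
  define p where "p = (1 / s) *\<^sub>R w"
  have "p $ i > 0" for i using pos s by (simp add: p_def)
  moreover have "(\<Sum>i\<in>UNIV. p $ i) = 1"
    using s by (simp add: p_def s_def flip: sum_divide_distrib)
  moreover have "p v* P = p" using wP
    by (simp add: p_def vec_eq_iff vector_matrix_mult_def mult.left_commute flip: sum_distrib_left sum_divide_distrib)
  ultimately show ?thesis by blast
qed

section \<open>The weighted square norm, the drift and contraction estimates\<close>

locale irreducible_chain =
  fixes P :: "real ^ 'n ^ 'n" and \<pi> :: "real ^ 'n"
  assumes P_nonneg: "P $ i $ j \<ge> 0"
    and P_one: "P *v 1 = 1"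
    and P_irr: "irreducible_mat P"
    and pi_pos: "\<pi> $ i > 0"
    and pi_sum: "(\<Sum>i\<in>UNIV. \<pi> $ i) = 1"
    and pi_stat: "\<pi> v* P = \<pi>"
begin

lemma Pv_nth: "(P *v x) $ i = (\<Sum>j\<in>UNIV. P $ i $ j * x $ j)"
  by (simp add: matrix_vector_mult_def)

lemma pi_inner_P: "\<pi> \<bullet> (P *v x) = \<pi> \<bullet> x"
  by (simp add: pi_stat flip: dot_lmul_matrix)

lemma pi_inner_one: "\<pi> \<bullet> 1 = 1"
  using pi_sum by (simp add: inner_vec_def)

definition msq :: "real ^ 'n \<Rightarrow> real" where
  "msq x = (\<Sum>i\<in>UNIV. \<pi> $ i * (x $ i)\<^sup>2)"

text \<open>The orthogonal projection off the constants for the inner product of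
  \<open>L2(\<pi>)\<close>, whose squared norm is \<open>msq\<close>; thus
  \<open>msq (center x)\<close> is the variance of \<open>x\<close> under
  \<open>\<pi>\<close>.\<close>

definition center :: "real ^ 'n \<Rightarrow> real ^ 'n" where
  "center x = x - (\<pi> \<bullet> x) *\<^sub>R 1"

lemma msq_eq_norm: "msq x = (norm (\<chi> i. sqrt (\<pi> $ i) * x $ i))\<^sup>2"
  using pi_pos by (simp add: msq_def norm_vec_def L2_set_def sum_nonneg power_mult_distrib less_imp_le)

lemma msq_nonneg: "msq x \<ge> 0"
  by (simp add: msq_eq_norm)

lemma msq_scale: "msq (c *\<^sub>R x) = c\<^sup>2 * msq x"
  by (simp add: msq_def power_mult_distrib sum_distrib_left mult.left_commute)

lemma msq_triangle: "sqrt (msq (x + y)) \<le> sqrt (msq x) + sqrt (msq y)"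
proof -
  have "(\<chi> i. sqrt (\<pi> $ i) * (x + y) $ i) = (\<chi> i. sqrt (\<pi> $ i) * x $ i) + (\<chi> i. sqrt (\<pi> $ i) * y $ i)"
    by (simp add: vec_eq_iff algebra_simps)
  then show ?thesis unfolding msq_eq_norm by (simp add: norm_triangle_ineq)
qed

lemma msq_ge_component: "\<pi> $ i * (x $ i)\<^sup>2 \<le> msq x"
  unfolding msq_def by (rule member_le_sum) (use pi_pos in \<open>auto simp: less_imp_le\<close>)

lemma msq_eq_0_iff: "msq x = 0 \<longleftrightarrow> x = 0"
  using pi_pos unfolding msq_def
  by (subst sum_nonneg_eq_0_iff) (auto simp: vec_eq_iff less_imp_le less_imp_neq[symmetric])

text \<open>Jensen's inequality in each row, averaged with the stationary weights. The matrix is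
  kept general because the Doeblin remainder is treated in the same way as \<open>P\<close>.\<close>

lemma msq_stochastic_le:
  fixes R :: "real ^ 'n ^ 'n"
  assumes nn: "\<And>i j. R $ i $ j \<ge> 0" and one: "R *v 1 = 1" and stat: "\<pi> v* R = \<pi>"
  shows "msq (R *v x) \<le> msq x"
proof -
  have jensen: "((R *v x) $ i)\<^sup>2 \<le> (\<Sum>j\<in>UNIV. R $ i $ j * (x $ j)\<^sup>2)" for i
  proof -
    define s where "s = (R *v x) $ i"
    \<comment> \<open>The variance of \<open>x\<close> under the probability vector given by row
      \<open>i\<close>.\<close>
    have "0 \<le> (\<Sum>j\<in>UNIV. R $ i $ j * (x $ j - s)\<^sup>2)" using nn by (intro sum_nonneg) auto
    also have "\<dots> = (\<Sum>j\<in>UNIV. R $ i $ j * (x $ j)\<^sup>2 - 2 * s * (R $ i $ j * x $ j) + s\<^sup>2 * R $ i $ j)"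
      by (simp add: power2_eq_square algebra_simps)
    also have "\<dots> = (\<Sum>j\<in>UNIV. R $ i $ j * (x $ j)\<^sup>2) - 2 * s * s + s\<^sup>2 * 1"
      by (simp only: sum.distrib sum_subtractf flip: sum_distrib_left)
        (simp add: s_def matrix_vector_mult_def row_sum_1[OF one])
    finally show ?thesis by (simp add: s_def power2_eq_square)
  qed
  have "msq (R *v x) \<le> (\<Sum>i\<in>UNIV. \<pi> $ i * (\<Sum>j\<in>UNIV. R $ i $ j * (x $ j)\<^sup>2))"
    unfolding msq_def using pi_pos by (intro sum_mono mult_left_mono jensen) (auto simp: less_imp_le)
  also have "\<dots> = (\<Sum>j\<in>UNIV. (\<Sum>i\<in>UNIV. \<pi> $ i * R $ i $ j) * (x $ j)\<^sup>2)"
    unfolding sum_distrib_left sum_distrib_right by (subst sum.swap) (simp add: ac_simps)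
  also have "\<dots> = msq x" using stat by (simp add: msq_def vec_eq_iff vector_matrix_mult_def)
  finally show ?thesis .
qed

lemma msq_P_le: "msq (P *v x) \<le> msq x"
  by (rule msq_stochastic_le[OF P_nonneg P_one pi_stat])

lemma pi_inner_center: "\<pi> \<bullet> center x = 0"
  by (simp add: center_def inner_diff_right pi_inner_one)

lemma center_P: "center (P *v x) = P *v center x"
  by (simp add: center_def pi_inner_P matrix_vector_mult_diff_distrib P_one
      matrix_vector_mult_scaleR)

lemma linear_center: "linear center"
  by (rule linearI) (simp_all add: center_def inner_add_right algebra_simps)

lemma msq_center: "msq (center x) = msq x - (\<pi> \<bullet> x)\<^sup>2"
proof -
  define s where "s = \<pi> \<bullet> x"
  have "msq (center x) = (\<Sum>i\<in>UNIV. \<pi> $ i * (x $ i)\<^sup>2 - 2 * s * (\<pi> $ i * x $ i) + s\<^sup>2 * \<pi> $ i)"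
    by (simp add: msq_def center_def power2_eq_square algebra_simps flip: s_def)
  also have "\<dots> = msq x - 2 * s * s + s\<^sup>2 * 1"
    by (simp only: sum.distrib sum_subtractf flip: sum_distrib_left)
      (simp add: s_def inner_vec_def msq_def pi_sum)
  finally show ?thesis by (simp add: s_def power2_eq_square)
qed

text \<open>Maximum principle: the maximal entry is an average of all entries with the weights of a
  row of \<open>matpow P k\<close>, so each index of positive weight attains the maximum, and
  irreducibility reaches every index.\<close>

lemma harmonic_imp_constant:
  assumes "P *v x = x"
  shows "x $ i = x $ j"
proof -
  define m where "m = Max (range (\<lambda>i. x $ i))"
  have "m \<in> range (\<lambda>i. x $ i)" unfolding m_def by (intro Max_in) auto
  then obtain a where a: "x $ a = m" by auto
  have le: "x $ b \<le> x $ a" for b unfolding a m_def by (intro Max_ge) auto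
  have "x $ b = x $ a" for b
  proof -
    obtain k where k: "matpow P k $ a $ b > 0" using P_irr by (auto simp: irreducible_mat_def)
    have fx: "(\<Sum>j\<in>UNIV. matpow P k $ a $ j * x $ j) = x $ a"
      using matpow_vector_fixed[OF assms, of k] by (simp add: vec_eq_iff matrix_vector_mult_def)
    have "(\<Sum>j\<in>UNIV. matpow P k $ a $ j * (x $ a - x $ j)) = 0"
      using row_sum_1[OF matpow_vector_fixed[OF P_one, of k], of a] fx
      by (simp add: right_diff_distrib sum_subtractf flip: sum_distrib_right)
    then have "matpow P k $ a $ b * (x $ a - x $ b) = 0"
      using le matpow_nonneg[OF P_nonneg] by (subst (asm) sum_nonneg_eq_0_iff) auto
    with k show ?thesis by simp
  qed
  then show ?thesis by metis
qed

definition drift :: "real \<Rightarrow> real ^ 'n \<Rightarrow> real ^ 'n" where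
  "drift r x = (1 - r) *\<^sub>R x + r *\<^sub>R (P *v x)"

lemma linear_drift: "linear (drift r)"
  by (rule linearI)
    (simp_all add: drift_def matrix_vector_right_distrib matrix_vector_mult_scaleR algebra_simps)

lemma drift_P: "drift r (P *v x) = P *v drift r x"
  by (simp add: drift_def matrix_vector_right_distrib matrix_vector_mult_scaleR)

lemma pi_inner_drift: "\<pi> \<bullet> drift r x = \<pi> \<bullet> x"
  by (simp add: drift_def inner_add_right pi_inner_P algebra_simps)

lemma drift_one: "drift r 1 = 1"
  by (simp add: drift_def P_one algebra_simps)

lemma center_drift: "center (drift r x) = drift r (center x)"
  by (simp add: center_def pi_inner_drift linear_diff[OF linear_drift] linear_cmul[OF linear_drift] drift_one)

text \<open>The convexity defect of the square, coordinate by coordinate. Its weight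
  \<open>r * (1 - r)\<close> is what makes the series over \<open>r n * (1 - r n)\<close>
  decisive.\<close>

lemma msq_drift:
  "msq (drift r x) = (1 - r) * msq x + r * msq (P *v x) - r * (1 - r) * msq (x - P *v x)"
proof -
  have "\<pi> $ i * (drift r x $ i)\<^sup>2 = (1 - r) * (\<pi> $ i * (x $ i)\<^sup>2) + r * (\<pi> $ i * ((P *v x) $ i)\<^sup>2)
      - r * (1 - r) * (\<pi> $ i * ((x - P *v x) $ i)\<^sup>2)" for i
    by (simp add: drift_def power2_eq_square algebra_simps)
  then show ?thesis
    by (simp add: msq_def sum.distrib sum_subtractf sum_distrib_left)
qed

lemma msq_drift_le:
  assumes "0 \<le> r" "r \<le> 1"
  shows "msq (drift r x) \<le> msq x - r * (1 - r) * msq (x - P *v x)"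
proof -
  have "r * msq (P *v x) \<le> r * msq x" using assms msq_P_le by (intro mult_left_mono)
  then show ?thesis unfolding msq_drift by (simp add: algebra_simps)
qed

lemma msq_drift_le':
  assumes "0 \<le> r" "r \<le> 1"
  shows "msq (drift r x) \<le> msq x"
  using msq_drift_le[OF assms, of x] msq_nonneg[of "x - P *v x"] assms
  by (smt (verit) mult_nonneg_nonneg)

text \<open>On the hyperplane of \<open>\<pi>\<close>-mean zero the map \<open>x - P *v x\<close> is
  injective, since harmonic vectors are constant and a constant of mean zero vanishes. An injective
  linear map in finite dimension is bounded below.\<close>

lemma spectral_gap:
  "\<exists>c>0. \<forall>x. \<pi> \<bullet> x = 0 \<longrightarrow> c * msq x \<le> msq (x - P *v x)"
proof -
  define S where "S x = (\<chi> i. sqrt (\<pi> $ i) * x $ i)" for x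
  have nS: "msq x = (norm (S x))\<^sup>2" for x by (simp add: msq_eq_norm S_def)
  define f where "f = (\<lambda>x. S (x - P *v x))"
  have linf: "linear f"
    by (rule linearI) (simp_all add: f_def S_def vec_eq_iff matrix_vector_right_distrib matrix_vector_mult_scaleR algebra_simps)
  have sub: "subspace {x. \<pi> \<bullet> x = 0}" by (rule subspace_hyperplane)
  have ker: "x = 0" if "x \<in> {x. \<pi> \<bullet> x = 0}" "f x = 0" for x
  proof -
    have "msq (x - P *v x) = 0" using that by (simp add: nS f_def)
    then have "P *v x = x" by (simp add: msq_eq_0_iff)
    then have cst: "x $ i = x $ j" for i j by (rule harmonic_imp_constant)
    define c where "c = x $ undefined"
    have "x = c *\<^sub>R 1" using cst by (simp add: vec_eq_iff c_def)
    with that(1) pi_inner_one show ?thesis by (metis (mono_tags) inner_scaleR_right mem_Collect_eq mult.right_neutral scale_eq_0_iff)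
  qed
  obtain e where e: "e > 0" "\<And>x. \<pi> \<bullet> x = 0 \<Longrightarrow> norm (f x) \<ge> e * norm x"
    using injective_imp_isometric[OF closed_subspace[OF sub] sub linear_conv_bounded_linear[THEN iffD1, OF linf]] ker by auto
  \<comment> \<open>The isometry constant \<open>e\<close> refers to the Euclidean norm of
    \<open>x\<close>; as each weight is at most 1, that norm dominates the weighted one and
    \<open>e\<^sup>2\<close> serves as the gap.\<close>
  have Sle: "norm (S x) \<le> norm x" for x
    unfolding norm_vec_def
  proof (rule L2_set_mono)
    fix i
    have "\<pi> $ i \<le> 1" using member_le_sum[of i UNIV "\<lambda>i. \<pi> $ i"] pi_pos pi_sum by (auto simp: less_imp_le)
    then show "norm (S x $ i) \<le> norm (x $ i)"
      using pi_pos[of i] by (simp add: S_def abs_mult mult_left_le_one_le)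
  qed auto
  have "e\<^sup>2 * msq x \<le> msq (x - P *v x)" if "\<pi> \<bullet> x = 0" for x
  proof -
    have "e * norm (S x) \<le> e * norm x" using e Sle by simp
    also have "\<dots> \<le> norm (f x)" using e that by simp
    finally have "(e * norm (S x))\<^sup>2 \<le> (norm (f x))\<^sup>2" using e by (intro power_mono) auto
    then show ?thesis by (simp add: nS f_def power_mult_distrib)
  qed
  with e(1) show ?thesis by (intro exI[of _ "e\<^sup>2"]) auto
qed

text \<open>Return times to \<open>i\<close> are closed under addition and have gcd 1, so all large
  times occur. Appending a path from \<open>i\<close> to \<open>j\<close> covers each of the
  finitely many pairs.\<close>

lemma aperiodic_imp_positive_power:
  assumes "mat_period P = 1"
  shows "\<exists>m. \<forall>i j. matpow P m $ i $ j > 0"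
proof -
  have ret: "\<exists>n0. \<forall>n\<ge>n0. n \<in> return_times P i" for i
  proof (rule additive_gcd_1_eventually)
    show "Gcd (return_times P i) = 1"
      using assms mat_period_eq[OF P_nonneg P_irr, of i] by simp
  qed (auto simp: return_times_def intro: matpow_add_pos[OF P_nonneg])
  have "\<exists>n0. \<forall>n\<ge>n0. matpow P n $ i $ j > 0" for i j
  proof -
    obtain k where k: "matpow P k $ i $ j > 0" using P_irr by (auto simp: irreducible_mat_def)
    obtain n0 where n0: "\<And>n. n \<ge> n0 \<Longrightarrow> matpow P n $ i $ i > 0"
      using ret[of i] by (auto simp: return_times_def)
    have "matpow P n $ i $ j > 0" if "n \<ge> n0 + k" for n
      using matpow_add_pos[OF P_nonneg n0[of "n - k"] k] that by simp
    then show ?thesis by blast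
  qed
  then have "eventually (\<lambda>n. matpow P n $ i $ j > 0) sequentially" for i j
    by (simp add: eventually_sequentially)
  then have "eventually (\<lambda>n. \<forall>i j. matpow P n $ i $ j > 0) sequentially"
    by (intro eventually_all_finite)
  then show ?thesis by (auto simp: eventually_sequentially)
qed

text \<open>Doeblin minorization: if \<open>P\<^sup>m \<ge> \<delta>\<close> entrywise, then \<open>P\<^sup>m - \<delta> 1 \<pi>\<^sup>T\<close> is \<open>1 - \<delta>\<close> times a stochastic matrix
  with stationary vector \<open>\<pi>\<close>, and the subtracted part kills centered vectors.\<close>

lemma aperiodic_contraction:
  assumes "mat_period P = 1"
  shows "\<exists>m \<rho>. \<rho> < 1 \<and> (\<forall>x. \<pi> \<bullet> x = 0 \<longrightarrow> msq (matpow P m *v x) \<le> \<rho> * msq x)"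
proof -
  obtain m where m: "\<And>i j. matpow P m $ i $ j > 0" using aperiodic_imp_positive_power[OF assms] by blast
  define A where "A = matpow P m"
  \<comment> \<open>The smallest entry gives the minorization; the cap \<open>1/2\<close> keeps the
    divisor \<open>1 - \<delta>\<close> in \<open>R\<close> positive.\<close>
  define \<delta> where "\<delta> = min (1/2) (Min (range (\<lambda>(i, j). A $ i $ j)))"
  have d0: "\<delta> > 0" using m by (auto simp: \<delta>_def A_def)
  have d1: "\<delta> < 1" by (simp add: \<delta>_def)
  have dA: "\<delta> \<le> A $ i $ j" for i j
    unfolding \<delta>_def by (rule min.coboundedI2, rule Min_le) auto
  define R where "R = (\<chi> i j. (A $ i $ j - \<delta> * \<pi> $ j) / (1 - \<delta>))"
  have pi1: "\<pi> $ i \<le> 1" for i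
    using member_le_sum[of i UNIV "\<lambda>i. \<pi> $ i"] pi_pos pi_sum by (auto simp: less_imp_le)
  have A1: "(\<Sum>j\<in>UNIV. A $ i $ j) = 1" for i
    unfolding A_def by (intro row_sum_1 matpow_vector_fixed P_one)
  have Api: "(\<Sum>i\<in>UNIV. \<pi> $ i * A $ i $ j) = \<pi> $ j" for j
    using vector_matpow_fixed[OF pi_stat, of m] by (simp add: A_def vec_eq_iff vector_matrix_mult_def)
  have Rle: "msq (R *v x) \<le> msq x" for x
  proof (rule msq_stochastic_le)
    fix i j
    have "\<delta> * \<pi> $ j \<le> \<delta> * 1" using d0 pi1 by (intro mult_left_mono) auto
    then show "R $ i $ j \<ge> 0" using dA[of i j] d1 by (simp add: R_def)
  next
    show "R *v 1 = 1" using d1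
      by (simp add: vec_eq_iff matrix_vector_mult_def R_def sum_subtractf A1 pi_sum flip: sum_divide_distrib sum_distrib_left)
  next
    have "(\<Sum>i\<in>UNIV. \<pi> $ i * R $ i $ j) = \<pi> $ j" for j
    proof -
      have "(\<Sum>i\<in>UNIV. \<pi> $ i * R $ i $ j) = (\<Sum>i\<in>UNIV. \<pi> $ i * A $ i $ j - \<delta> * \<pi> $ j * \<pi> $ i) / (1 - \<delta>)"
        by (simp add: R_def sum_divide_distrib right_diff_distrib mult_ac)
      also have "\<dots> = (\<pi> $ j - \<delta> * \<pi> $ j) / (1 - \<delta>)"
        by (simp only: sum_subtractf Api pi_sum flip: sum_distrib_left) simp
      also have "\<dots> = \<pi> $ j" using d1 by (simp add: field_simps)
      finally show ?thesis .
    qed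
    then show "\<pi> v* R = \<pi>" by (simp add: vec_eq_iff vector_matrix_mult_def)
  qed
  have "msq (A *v x) \<le> (1 - \<delta>)\<^sup>2 * msq x" if x: "\<pi> \<bullet> x = 0" for x
  proof -
    have "A *v x = (1 - \<delta>) *\<^sub>R (R *v x)"
    proof -
      have "(1 - \<delta>) * (\<Sum>j\<in>UNIV. R $ i $ j * x $ j) = (\<Sum>j\<in>UNIV. A $ i $ j * x $ j - \<delta> * (\<pi> $ j * x $ j))" for i
      proof -
        have "(1 - \<delta>) * (R $ i $ j * x $ j) = A $ i $ j * x $ j - \<delta> * (\<pi> $ j * x $ j)" for j
        proof -
          have "(1 - \<delta>) * R $ i $ j = A $ i $ j - \<delta> * \<pi> $ j" using d1 by (simp add: R_def)
          then show ?thesis by (simp add: left_diff_distrib flip: mult.assoc)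
        qed
        then show ?thesis by (simp add: sum_distrib_left)
      qed
      then show ?thesis using x
        by (simp add: vec_eq_iff matrix_vector_mult_def sum_subtractf inner_vec_def flip: sum_distrib_left)
    qed
    then show ?thesis using Rle by (simp add: msq_scale mult_left_mono)
  qed
  moreover have "(1 - \<delta>)\<^sup>2 < 1" using d0 d1 by (simp add: power_less_one_iff abs_square_less_1)
  ultimately show ?thesis unfolding A_def by blast
qed

end

section \<open>Products of drifts\<close>

context irreducible_chain begin

fun flow :: "(nat \<Rightarrow> real) \<Rightarrow> nat \<Rightarrow> nat \<Rightarrow> real ^ 'n \<Rightarrow> real ^ 'n" where
  "flow r n 0 x = x"
| "flow r n (Suc m) x = drift (r (n + m)) (flow r n m x)"

text \<open>Splits off the earliest drift instead of the latest one, as needed when a step of the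
  process precedes a flow.\<close>

lemma flow_Suc_left: "flow r n (Suc m) x = flow r (Suc n) m (drift (r n) x)"
  by (induction m) simp_all

lemma linear_flow: "linear (flow r n m)"
proof (induction m)
  case 0
  then show ?case using linear_id by (simp add: id_def)
next
  case (Suc m)
  have "flow r n (Suc m) = drift (r (n + m)) \<circ> flow r n m" by (simp add: fun_eq_iff)
  then show ?case using linear_compose[OF Suc linear_drift] by metis
qed

lemma flow_P: "flow r n m (P *v x) = P *v flow r n m x"
  by (induction m) (simp_all add: drift_P)

lemma flow_matpow: "flow r n m (matpow P j *v x) = matpow P j *v flow r n m x"
  by (induction j arbitrary: x) (simp_all add: flow_P flip: matrix_vector_mul_assoc)

lemma pi_inner_flow: "\<pi> \<bullet> flow r n m x = \<pi> \<bullet> x"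
  by (induction m) (simp_all add: pi_inner_drift)

lemma msq_minus: "msq (- x) = msq x"
  by (simp add: msq_def)

text \<open>The difference of \<open>drift r x\<close> and \<open>P *v x\<close> is
  \<open>1 - r\<close> times \<open>x - P *v x\<close>, whose norm is at most twice that of
  \<open>x\<close>. So a drift with \<open>r\<close> close to 1 acts almost like
  \<open>P\<close>.\<close>

lemma msq_drift_lipschitz:
  assumes "0 \<le> r" "r \<le> 1"
  shows "\<bar>sqrt (msq (drift r x)) - sqrt (msq (P *v x))\<bar> \<le> 2 * (1 - r) * sqrt (msq x)"
proof -
  have eq: "drift r x = P *v x + (1 - r) *\<^sub>R (x + (-1) *\<^sub>R (P *v x))"
    by (simp add: drift_def algebra_simps)
  \<comment> \<open>The same decomposition solved for \<open>P *v x\<close>, for the other half of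
    the reverse triangle inequality.\<close>
  have eq2: "P *v x = drift r x + (-(1 - r)) *\<^sub>R (x + (-1) *\<^sub>R (P *v x))"
    by (simp add: drift_def algebra_simps)
  have "sqrt (msq (x + (-1) *\<^sub>R (P *v x))) \<le> sqrt (msq x) + sqrt (msq (P *v x))"
    using msq_triangle[of x "(-1) *\<^sub>R (P *v x)"] by (simp add: msq_scale msq_minus)
  also have "\<dots> \<le> 2 * sqrt (msq x)" using msq_P_le[of x] by simp
  finally have d: "sqrt (msq (x + (-1) *\<^sub>R (P *v x))) \<le> 2 * sqrt (msq x)" .
  have "sqrt (msq (c *\<^sub>R (x + (-1) *\<^sub>R (P *v x)))) \<le> 2 * (1 - r) * sqrt (msq x)" if "\<bar>c\<bar> = 1 - r" for c
  proof -
    have "sqrt (msq (c *\<^sub>R (x + (-1) *\<^sub>R (P *v x)))) = (1 - r) * sqrt (msq (x + (-1) *\<^sub>R (P *v x)))"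
      unfolding msq_scale real_sqrt_mult real_sqrt_abs that ..
    also have "\<dots> \<le> (1 - r) * (2 * sqrt (msq x))" using d assms by (intro mult_left_mono) auto
    finally show ?thesis by (simp only: mult_ac)
  qed
  from this[of "1 - r"] this[of "-(1 - r)"] show ?thesis
    using msq_triangle[of "P *v x" "(1 - r) *\<^sub>R (x + (-1) *\<^sub>R (P *v x))"]
      msq_triangle[of "drift r x" "(-(1 - r)) *\<^sub>R (x + (-1) *\<^sub>R (P *v x))"] assms
    unfolding eq[symmetric] eq2[symmetric] by linarith
qed

context
  fixes r :: "nat \<Rightarrow> real"
  assumes r: "0 \<le> r n \<and> r n \<le> 1"
begin

lemma msq_flow_decseq:
  shows "decseq (\<lambda>m. msq (flow r n m x))"
  by (rule decseq_SucI) (use r msq_drift_le' in auto)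

lemma msq_flow_le:
  shows "msq (flow r n m x) \<le> msq x"
  using decseqD[OF msq_flow_decseq, of 0 m] by simp

lemma msq_flow_convergent:
  shows "\<exists>L. (\<lambda>m. msq (flow r n m x)) \<longlonglongrightarrow> L"
  using decseq_convergent[OF msq_flow_decseq, of 0] msq_nonneg by metis

text \<open>The energies decrease to some \<open>L\<close>. If \<open>L > 0\<close>, the spectral
  gap makes step \<open>k\<close> lose at least \<open>c * L * r k * (1 - r k)\<close>; the total
  loss is at most \<open>msq x\<close>, which would make the series converge.\<close>

lemma flow_tendsto_0_divergent:
  assumes div: "\<not> summable (\<lambda>n. r n * (1 - r n))"
    and x: "\<pi> \<bullet> x = 0"
  shows "(\<lambda>m. msq (flow r n m x)) \<longlonglongrightarrow> 0"
proof -
  obtain c where c: "c > 0" "\<And>x. \<pi> \<bullet> x = 0 \<Longrightarrow> c * msq x \<le> msq (x - P *v x)"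
    using spectral_gap by blast
  obtain L where L: "(\<lambda>m. msq (flow r n m x)) \<longlonglongrightarrow> L" using msq_flow_convergent by blast
  have L0: "L \<ge> 0" using L by (rule LIMSEQ_le_const) (simp add: msq_nonneg)
  have Lle: "L \<le> msq (flow r n m x)" for m using decseq_ge[OF msq_flow_decseq L] .
  have "L = 0"
  proof (rule ccontr)
    assume "L \<noteq> 0"
    with L0 have Lp: "L > 0" by simp
    have bound: "c * L * (\<Sum>k<m. r (n + k) * (1 - r (n + k))) + msq (flow r n m x) \<le> msq x" for m
    proof (induction m)
      case (Suc m)
      let ?y = "flow r n m x" and ?a = "r (n + m) * (1 - r (n + m))"
      have a: "?a \<ge> 0" using r by simp
      have "c * L \<le> c * msq ?y" using c(1) Lle by simp
      also have "\<dots> \<le> msq (?y - P *v ?y)" using x by (intro c(2)) (simp add: pi_inner_flow)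
      finally have "?a * (c * L) \<le> ?a * msq (?y - P *v ?y)" using a by (rule mult_left_mono)
      moreover have "msq (drift (r (n + m)) ?y) \<le> msq ?y - ?a * msq (?y - P *v ?y)"
        using r by (intro msq_drift_le) auto
      ultimately show ?case using Suc by (simp add: algebra_simps)
    qed simp
    have "(\<Sum>k<m. r (n + k) * (1 - r (n + k))) \<le> msq x / (c * L)" for m
      using bound[of m] msq_nonneg[of "flow r n m x"] c(1) Lp by (simp add: field_simps)
    then have "summable (\<lambda>k. r (n + k) * (1 - r (n + k)))"
      using r by (intro summableI_nonneg_bounded) auto
    then have "summable (\<lambda>k. r (k + n) * (1 - r (k + n)))" by (simp add: add.commute)
    then show False using div by (simp only: summable_iff_shift[of "\<lambda>k. r k * (1 - r k)"])
  qed
  with L show ?thesis by simp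
qed

text \<open>The limits of \<open>msq (flow r n m x)\<close> and \<open>msq (flow r n m (P *v x))\<close> agree because \<open>drift (r k)\<close> is almost
  \<open>P\<close> along a subsequence; iterating, the limit is not changed by a power of \<open>P\<close>, which is a contraction.\<close>

lemma flow_tendsto_0_aperiodic:
  assumes freq: "\<And>e. e > 0 \<Longrightarrow> \<exists>\<^sub>F n in sequentially. r n > 1 - e"
    and ap: "mat_period P = 1" and x: "\<pi> \<bullet> x = 0"
  shows "(\<lambda>m. msq (flow r n m x)) \<longlonglongrightarrow> 0"
proof -
  define L where "L x = lim (\<lambda>m. msq (flow r n m x))" for x
  have L: "(\<lambda>m. msq (flow r n m x)) \<longlonglongrightarrow> L x" for x
    using msq_flow_convergent unfolding L_def by (metis limI)
  have LP: "L (P *v x) = L x" for x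
  proof (rule ccontr)
    assume ne: "L (P *v x) \<noteq> L x"
    \<comment> \<open>After \<open>m\<close> common drifts, one more drift is compared with an
      application of \<open>P\<close>; the latter commutes with the flow.\<close>
    define a where "a m = sqrt (msq (flow r n (Suc m) x)) - sqrt (msq (flow r n m (P *v x)))" for m
    \<comment> \<open>The summand 1 keeps \<open>K\<close> positive when \<open>msq x = 0\<close>.
      The choice \<open>1 - r k < d / (2 * K)\<close> below then forces
      \<open>\<bar>a m\<bar> < d / 2\<close>.\<close>
    define K where "K = 2 * sqrt (msq x) + 1"
    have K: "K > 0" using msq_nonneg[of x] by (simp add: K_def add_nonneg_pos)
    have "a \<longlonglongrightarrow> sqrt (L x) - sqrt (L (P *v x))"
      unfolding a_def by (intro tendsto_diff tendsto_real_sqrt LIMSEQ_Suc[OF L] L)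
    then have lim: "(\<lambda>m. \<bar>a m\<bar>) \<longlonglongrightarrow> \<bar>sqrt (L x) - sqrt (L (P *v x))\<bar>" by (rule tendsto_rabs)
    define d where "d = \<bar>sqrt (L x) - sqrt (L (P *v x))\<bar>"
    have d: "d > 0" using ne by (simp add: d_def)
    have "eventually (\<lambda>m. \<bar>a m\<bar> > d / 2) sequentially"
      using lim d unfolding d_def by (intro order_tendstoD(1)) auto
    then obtain m0 where m0: "\<And>m. m \<ge> m0 \<Longrightarrow> \<bar>a m\<bar> > d / 2" by (auto simp: eventually_sequentially)
    have "\<exists>\<^sub>F k in sequentially. r k > 1 - d / (2 * K)" using d K by (intro freq) simp
    then obtain k where k: "k \<ge> n + m0" "r k > 1 - d / (2 * K)"
      unfolding frequently_sequentially by blast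
    define m where "m = k - n"
    have m: "m \<ge> m0" "k = n + m" using k by (auto simp: m_def)
    have "\<bar>a m\<bar> \<le> 2 * (1 - r k) * sqrt (msq (flow r n m x))"
      unfolding a_def flow_P flow.simps m(2)[symmetric] using r by (intro msq_drift_lipschitz) auto
    also have "\<dots> \<le> 2 * (1 - r k) * sqrt (msq x)"
      using r msq_flow_le by (intro mult_left_mono) auto
    also have "\<dots> \<le> (1 - r k) * K" using r[of k] by (simp add: K_def algebra_simps)
    also have "\<dots> < d / (2 * K) * K" using k(2) K by (intro mult_strict_right_mono) auto
    also have "\<dots> = d / 2" using K by simp
    finally show False using m0[OF m(1)] by simp
  qed
  have LPm: "L (matpow P j *v x) = L x" for j x
    by (induction j arbitrary: x) (simp_all add: LP flip: matrix_vector_mul_assoc)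
  obtain m \<rho> where m: "\<rho> < 1" "\<And>x. \<pi> \<bullet> x = 0 \<Longrightarrow> msq (matpow P m *v x) \<le> \<rho> * msq x"
    using aperiodic_contraction[OF ap] by blast
  have "L (matpow P m *v x) \<le> \<rho> * L x"
  proof (rule LIMSEQ_le[OF L tendsto_mult_left[OF L]], intro exI allI impI)
    fix k
    show "msq (flow r n k (matpow P m *v x)) \<le> \<rho> * msq (flow r n k x)"
      unfolding flow_matpow using x by (intro m(2)) (simp add: pi_inner_flow)
  qed
  then have "(1 - \<rho>) * L x \<le> 0" by (simp add: LPm algebra_simps)
  moreover have "L x \<ge> 0" using L by (rule LIMSEQ_le_const) (simp add: msq_nonneg)
  ultimately have "L x = 0" using m(1) by (simp add: mult_le_0_iff)
  with L show ?thesis by metis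
qed

end

end

section \<open>Cyclic classes\<close>

text \<open>The two sides differ by \<open>r * (1 - r) * (u + v)\<^sup>2\<close>. The weights on the
  left add up to \<open>(1 - 2 * r)\<^sup>2 = 1 - 4 * (r * (1 - r))\<close>, the loss factor wanted
  for quadratic forms.\<close>

lemma square_convex_combination_ge:
  fixes r u v :: real
  assumes "0 \<le> r" "r \<le> 1"
  shows "(1 - r) * (1 - 2 * r) * u\<^sup>2 + r * (2 * r - 1) * v\<^sup>2 \<le> ((1 - r) * u + r * v)\<^sup>2"
proof -
  have "((1 - r) * u + r * v)\<^sup>2 = (1 - r) * (1 - 2 * r) * u\<^sup>2 + r * (2 * r - 1) * v\<^sup>2 + r * (1 - r) * (u + v)\<^sup>2"
    by (simp add: power2_eq_square algebra_simps)
  moreover have "0 \<le> r * (1 - r) * (u + v)\<^sup>2" using assms by simp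
  ultimately show ?thesis by linarith
qed

lemma Suc_mod_inj:
  assumes "a < d" "b < d" "Suc a mod d = Suc b mod d"
  shows "a = b"
  using assms by (auto simp: mod_Suc split: if_splits)

lemma bij_betw_Suc_mod: "bij_betw (\<lambda>a. Suc a mod d) {..<d} {..<d}"
proof -
  have "inj_on (\<lambda>a. Suc a mod d) {..<d}" by (rule inj_onI, rule Suc_mod_inj[of _ d]) auto
  moreover have "(\<lambda>a. Suc a mod d) ` {..<d} \<subseteq> {..<d}" by auto
  ultimately show ?thesis using endo_inj_surj[OF finite_lessThan] by (auto simp: bij_betw_def)
qed

context irreducible_chain begin

text \<open>The coefficient \<open>r * (2 * r - 1)\<close> of the form at \<open>P *v x\<close>
  changes sign at \<open>r = 1/2\<close>: up to there contraction under \<open>P\<close> suffices,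
  beyond it invariance under \<open>P\<close> is used.\<close>

lemma sum_squares_drift_ge:
  assumes r: "0 \<le> r" "r \<le> 1" and lin: "\<And>a. a \<in> I \<Longrightarrow> linear (f a)"
    and le: "(\<Sum>a\<in>I. (f a (P *v x))\<^sup>2) \<le> (\<Sum>a\<in>I. (f a x)\<^sup>2)"
    and "r \<le> 1 / 2 \<or> (\<Sum>a\<in>I. (f a (P *v x))\<^sup>2) = (\<Sum>a\<in>I. (f a x)\<^sup>2)"
  shows "(1 - 4 * (r * (1 - r))) * (\<Sum>a\<in>I. (f a x)\<^sup>2) \<le> (\<Sum>a\<in>I. (f a (drift r x))\<^sup>2)"
proof -
  let ?U = "\<Sum>a\<in>I. (f a x)\<^sup>2" and ?V = "\<Sum>a\<in>I. (f a (P *v x))\<^sup>2"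
  have "r * (2 * r - 1) * ?U \<le> r * (2 * r - 1) * ?V"
    using assms(5)
  proof
    assume "r \<le> 1 / 2"
    then have "r * (2 * r - 1) \<le> 0" using r by (intro mult_nonneg_nonpos) auto
    with le show ?thesis by (rule mult_left_mono_neg)
  qed simp
  then have "(1 - 4 * (r * (1 - r))) * ?U \<le> (1 - r) * (1 - 2 * r) * ?U + r * (2 * r - 1) * ?V"
    by (simp add: algebra_simps)
  also have "\<dots> = (\<Sum>a\<in>I. (1 - r) * (1 - 2 * r) * (f a x)\<^sup>2 + r * (2 * r - 1) * (f a (P *v x))\<^sup>2)"
    by (simp add: sum.distrib sum_distrib_left)
  also have "\<dots> \<le> (\<Sum>a\<in>I. (f a (drift r x))\<^sup>2)"
  proof (rule sum_mono)
    fix a assume "a \<in> I"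
    then have "f a (drift r x) = (1 - r) * f a x + r * f a (P *v x)"
      using lin by (simp add: drift_def linear_add linear_cmul)
    then show "(1 - r) * (1 - 2 * r) * (f a x)\<^sup>2 + r * (2 * r - 1) * (f a (P *v x))\<^sup>2 \<le> (f a (drift r x))\<^sup>2"
      using square_convex_combination_ge[OF r] by simp
  qed
  finally show ?thesis .
qed

text \<open>The functionals are differences of the \<open>\<pi>\<close>-masses of consecutive cyclic classes, which \<open>P\<close> permutes.\<close>

lemma periodic_functionals:
  assumes d: "d = mat_period P" "d \<ge> 2"
  shows "\<exists>f :: nat \<Rightarrow> real ^ 'n \<Rightarrow> real. (\<forall>a. linear (f a)) \<and> (\<forall>a<d. f a 1 = 0) \<and>
    (\<forall>x. (\<Sum>a<d. (f a (P *v x))\<^sup>2) = (\<Sum>a<d. (f a x)\<^sup>2)) \<and>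
    (\<forall>l. (\<Sum>a<d. (f a (axis l 1))\<^sup>2) > 0)"
proof -
  define i0 :: 'n where "i0 = undefined"
  have dret: "d dvd k" if "matpow P k $ i0 $ i0 > 0" for k
  proof (cases "k \<ge> 1")
    case True
    then have "k \<in> return_times P i0" using that by (simp add: return_times_def)
    then show ?thesis unfolding d(1) mat_period_eq[OF P_nonneg P_irr, of i0] by (rule Gcd_dvd)
  next
    case False
    then have "k = 0" by simp
    then show ?thesis by simp
  qed
  have reach: "\<exists>k. matpow P k $ i $ j > 0" for i j using P_irr by (auto simp: irreducible_mat_def)
  \<comment> \<open>The cyclic class of \<open>i\<close>: the length modulo \<open>d\<close> of any
    path from \<open>i0\<close> to \<open>i\<close>. It does not depend on the path, since one
    return path closes any two of them to loops of length divisible by \<open>d\<close>.\<close>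
  define c where "c i = (SOME k. matpow P k $ i0 $ i > 0) mod d" for i
  have cd: "c i < d" for i using d by (simp add: c_def)
  have c_eq: "c i = k mod d" if k: "matpow P k $ i0 $ i > 0" for i k
  proof -
    define k' where "k' = (SOME k. matpow P k $ i0 $ i > 0)"
    have k': "matpow P k' $ i0 $ i > 0" unfolding k'_def using k by (rule someI)
    obtain b where b: "matpow P b $ i $ i0 > 0" using reach by blast
    have "(k + b) mod d = 0" "(k' + b) mod d = 0"
      using dret[OF matpow_add_pos[OF P_nonneg k b]] dret[OF matpow_add_pos[OF P_nonneg k' b]] by auto
    then have "(k' + b + k) mod d = k mod d" "(k + b + k') mod d = k' mod d"
      by (metis add_0 mod_add_left_eq)+
    moreover have "k' + b + k = k + b + k'" by simp
    ultimately show ?thesis by (simp add: c_def flip: k'_def)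
  qed
  have edge: "c j = Suc (c i) mod d" if "P $ i $ j \<noteq> 0" for i j
  proof -
    obtain k where k: "matpow P k $ i0 $ i > 0" using reach by blast
    have "matpow P 1 $ i $ j > 0" using that P_nonneg[of i j] by simp
    from matpow_add_pos[OF P_nonneg k this] have "c j = (k + 1) mod d" by (rule c_eq)
    also have "\<dots> = Suc (c i) mod d" using c_eq[OF k] by (simp add: mod_Suc_eq)
    finally show ?thesis .
  qed
  \<comment> \<open>The integral of \<open>x\<close> against \<open>\<pi>\<close> over class
    \<open>a\<close>.\<close>
  define m where "m a x = (\<Sum>i\<in>UNIV. of_bool (c i = a) * \<pi> $ i * x $ i)" for a :: nat and x :: "real ^ 'n"
  have linm: "linear (m a)" for a
    by (rule linearI) (simp_all add: m_def algebra_simps sum.distrib sum_distrib_left)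
  have mP: "m a (P *v x) = m (Suc a mod d) x" if a: "a < d" for a x
  proof -
    have "m a (P *v x) = (\<Sum>i\<in>UNIV. \<Sum>j\<in>UNIV. of_bool (c i = a) * \<pi> $ i * P $ i $ j * x $ j)"
      by (simp add: m_def Pv_nth sum_distrib_left mult.assoc)
    also have "\<dots> = (\<Sum>j\<in>UNIV. \<Sum>i\<in>UNIV. of_bool (c i = a) * \<pi> $ i * P $ i $ j * x $ j)"
      by (rule sum.swap)
    \<comment> \<open>Every edge advances the class by one, so starting in class \<open>a\<close> is
      the same as ending in the next class; the sum over \<open>i\<close> is then evaluated by
      stationarity.\<close>
    also have "\<dots> = (\<Sum>j\<in>UNIV. \<Sum>i\<in>UNIV. of_bool (c j = Suc a mod d) * x $ j * (\<pi> $ i * P $ i $ j))"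
    proof (intro sum.cong refl)
      fix i j
      show "of_bool (c i = a) * \<pi> $ i * P $ i $ j * x $ j = of_bool (c j = Suc a mod d) * x $ j * (\<pi> $ i * P $ i $ j)"
      proof (cases "P $ i $ j = 0")
        case False
        then have "c i = a \<longleftrightarrow> c j = Suc a mod d"
          using edge[OF False] Suc_mod_inj[OF a cd[of i]] by auto
        then show ?thesis by simp
      qed simp
    qed
    also have "\<dots> = (\<Sum>j\<in>UNIV. of_bool (c j = Suc a mod d) * x $ j * \<pi> $ j)"
      using pi_stat by (simp add: vec_eq_iff vector_matrix_mult_def flip: sum_distrib_left)
    also have "\<dots> = m (Suc a mod d) x" by (simp add: m_def ac_simps)
    finally show ?thesis .
  qed
  define f where "f a x = m a x - m (Suc a mod d) x" for a x
  have "linear (f a)" for a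
    unfolding f_def using linm by (intro linear_compose_sub)
  \<comment> \<open>The shift rule at the fixed vector \<open>1\<close> says that all classes have
    equal mass.\<close>
  moreover have "f a 1 = 0" if "a < d" for a
    using mP[OF that, of 1] by (simp add: f_def P_one)
  moreover have "(\<Sum>a<d. (f a (P *v x))\<^sup>2) = (\<Sum>a<d. (f a x)\<^sup>2)" for x
  proof -
    have "(\<Sum>a<d. (f a (P *v x))\<^sup>2) = (\<Sum>a<d. (f (Suc a mod d) x)\<^sup>2)"
      using d by (intro sum.cong) (auto simp: f_def mP)
    also have "\<dots> = (\<Sum>a<d. (f a x)\<^sup>2)"
      by (rule sum.reindex_bij_betw[OF bij_betw_Suc_mod, of "\<lambda>a. (f a x)\<^sup>2"])
    finally show ?thesis .
  qed
  moreover have "(\<Sum>a<d. (f a (axis l 1))\<^sup>2) > 0" for l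
  proof -
    have m_axis: "m a (axis l 1) = of_bool (c l = a) * \<pi> $ l" for a
      by (simp add: m_def axis_def if_distrib cong: if_cong)
    \<comment> \<open>For \<open>d \<ge> 2\<close> consecutive classes are distinct, so a unit
      vector is seen by only one of the two terms of \<open>f (c l)\<close>.\<close>
    have "Suc (c l) mod d \<noteq> c l" using d(2) cd[of l] by (auto simp: mod_Suc)
    then have "f (c l) (axis l 1) = \<pi> $ l" by (auto simp: f_def m_axis)
    then show ?thesis using cd[of l] pi_pos[of l] by (intro sum_pos2[of _ "c l"]) auto
  qed
  ultimately show ?thesis by blast
qed

end

section \<open>Second moments of the process\<close>

named_theorems bm_intros

text \<open>Boundedness on \<open>M\<close> is paired with measurability for a possibly smaller
  sigma-algebra \<open>F\<close>: closure rules then yield both integrability and the right to pull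
  a factor out of a conditional expectation.\<close>

definition bounded_measurable :: "'a measure \<Rightarrow> 'a measure \<Rightarrow> ('a \<Rightarrow> real) \<Rightarrow> bool" where
  "bounded_measurable M F f \<longleftrightarrow> f \<in> borel_measurable F \<and> (\<exists>B. \<forall>\<omega>\<in>space M. \<bar>f \<omega>\<bar> \<le> B)"

lemma bounded_measurableI:
  assumes "f \<in> borel_measurable F" "\<And>\<omega>. \<omega> \<in> space M \<Longrightarrow> \<bar>f \<omega>\<bar> \<le> B"
  shows "bounded_measurable M F f"
  using assms unfolding bounded_measurable_def by blast

lemma bounded_measurable_const [bm_intros]: "bounded_measurable M F (\<lambda>_. c)"
  by (rule bounded_measurableI[of _ _ _ "\<bar>c\<bar>"]) auto

lemma bounded_measurable_add [bm_intros]: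
  assumes "bounded_measurable M F f" "bounded_measurable M F g"
  shows "bounded_measurable M F (\<lambda>\<omega>. f \<omega> + g \<omega>)"
proof -
  obtain B C where "\<forall>\<omega>\<in>space M. \<bar>f \<omega>\<bar> \<le> B" "\<forall>\<omega>\<in>space M. \<bar>g \<omega>\<bar> \<le> C"
    using assms unfolding bounded_measurable_def by blast
  then show ?thesis using assms unfolding bounded_measurable_def
    by (auto intro!: exI[of _ "B + C"] abs_triangle_ineq[THEN order_trans] add_mono)
qed

lemma bounded_measurable_mult [bm_intros]:
  assumes "bounded_measurable M F f" "bounded_measurable M F g"
  shows "bounded_measurable M F (\<lambda>\<omega>. f \<omega> * g \<omega>)"
proof -
  obtain B C where "\<forall>\<omega>\<in>space M. \<bar>f \<omega>\<bar> \<le> B" "\<forall>\<omega>\<in>space M. \<bar>g \<omega>\<bar> \<le> C"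
    using assms unfolding bounded_measurable_def by blast
  then show ?thesis using assms unfolding bounded_measurable_def
    by (auto intro!: exI[of _ "B * C"] mult_mono' simp: abs_mult)
qed

lemma bounded_measurable_minus [bm_intros]:
  "bounded_measurable M F f \<Longrightarrow> bounded_measurable M F (\<lambda>\<omega>. - f \<omega>)"
  unfolding bounded_measurable_def by auto

lemma bounded_measurable_diff [bm_intros]:
  "bounded_measurable M F f \<Longrightarrow> bounded_measurable M F g \<Longrightarrow> bounded_measurable M F (\<lambda>\<omega>. f \<omega> - g \<omega>)"
  using bounded_measurable_add[OF _ bounded_measurable_minus, of M F f g] by simp

lemma bounded_measurable_power [bm_intros]:
  "bounded_measurable M F f \<Longrightarrow> bounded_measurable M F (\<lambda>\<omega>. f \<omega> ^ k)"
  by (induction k) (auto intro: bm_intros)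

lemma bounded_measurable_sum [bm_intros]:
  assumes "\<And>i. i \<in> I \<Longrightarrow> bounded_measurable M F (f i)"
  shows "bounded_measurable M F (\<lambda>\<omega>. \<Sum>i\<in>I. f i \<omega>)"
  using assms by (induction I rule: infinite_finite_induct) (auto intro: bm_intros)

lemma linear_expansion:
  fixes f :: "real ^ 'n \<Rightarrow> real"
  assumes "linear f"
  shows "f x = (\<Sum>l\<in>UNIV. x $ l * f (axis l 1))"
proof -
  have "f x = f (\<Sum>l\<in>UNIV. x $ l *\<^sub>R axis l 1)"
    using basis_expansion[of x] by (simp add: scalar_mult_eq_scaleR)
  then show ?thesis using assms by (simp add: linear_sum linear_cmul)
qed

section \<open>The filtration and the conditional moments of one step\<close>

locale reinforced_process = irreducible_chain P \<pi> + prob_space M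
  for P :: "real ^ 'n ^ 'n" and \<pi> :: "real ^ 'n" and M :: "'a measure" +
  fixes r :: "nat \<Rightarrow> real" and Z X :: "nat \<Rightarrow> 'a \<Rightarrow> real ^ 'n"
  assumes r_bounds: "0 < r n \<and> r n < 1"
    and Z0_meas: "Z 0 \<in> borel_measurable M"
    and Z0_range: "\<omega> \<in> space M \<Longrightarrow> Z 0 \<omega> $ l \<in> {0..1}"
    and X_meas: "X (Suc n) \<in> borel_measurable M"
    and X_range: "\<omega> \<in> space M \<Longrightarrow> X (Suc n) \<omega> $ l \<in> {0, 1}"
    and X_indep: "cond_indep_vars M (history M (Z 0) X n) (\<lambda>_. borel) (\<lambda>l \<omega>. X (Suc n) \<omega> $ l) UNIV"
    and X_mean: "AE \<omega> in M. cond_prob_sigma M (history M (Z 0) X n) {\<omega>'\<in>space M. X (Suc n) \<omega>' $ l = 1} \<omega> = (P *v Z n \<omega>) $ l"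
    and Z_Suc: "\<omega> \<in> space M \<Longrightarrow> Z (Suc n) \<omega> = (1 - r n) *\<^sub>R Z n \<omega> + r n *\<^sub>R X (Suc n) \<omega>"
begin

abbreviation F :: "nat \<Rightarrow> 'a measure" where "F n \<equiv> history M (Z 0) X n"

definition p :: "nat \<Rightarrow> 'n \<Rightarrow> 'a \<Rightarrow> real" where "p n l \<omega> = (P *v Z n \<omega>) $ l"

lemma measurable_component:
  fixes g :: "'a \<Rightarrow> real ^ 'n"
  assumes "g \<in> borel_measurable N"
  shows "(\<lambda>\<omega>. g \<omega> $ l) \<in> borel_measurable N"
  using assms by (rule measurable_compose) (intro borel_measurable_continuous_onI continuous_intros)

lemma space_F: "space (F n) = space M"
  unfolding history_def by (rule space_measure_of) auto

lemma sets_F: "sets (F n) = sigma_sets (space M)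
     ({(\<lambda>\<omega>. Z 0 \<omega> $ l) -` B \<inter> space M | l B. B \<in> sets borel} \<union>
      {(\<lambda>\<omega>. X k \<omega> $ l) -` B \<inter> space M | k l B. k \<in> {1..n} \<and> B \<in> sets borel})"
  unfolding history_def by (rule sets_measure_of) auto

lemma X_component_M: "(\<lambda>\<omega>. X (Suc n) \<omega> $ l) \<in> borel_measurable M"
  by (rule measurable_component[OF X_meas])

lemma F_subalg: "subalgebra M (F n)"
  unfolding subalgebra_def space_F sets_F
proof (intro conjI refl sets.sigma_sets_subset)
  have "(\<lambda>\<omega>. X k \<omega> $ l) -` B \<inter> space M \<in> sets M" if kB: "k \<in> {1..n}" "B \<in> sets borel" for k l B
  proof -
    obtain k' where "k = Suc k'" using kB by (cases k) auto
    then show ?thesis using measurable_sets[OF X_component_M kB(2)] by simp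
  qed
  moreover have "(\<lambda>\<omega>. Z 0 \<omega> $ l) -` B \<inter> space M \<in> sets M" if "B \<in> sets borel" for l B
    using measurable_sets[OF measurable_component[OF Z0_meas] that] .
  ultimately show "{(\<lambda>\<omega>. Z 0 \<omega> $ l) -` B \<inter> space M | l B. B \<in> sets borel} \<union>
      {(\<lambda>\<omega>. X k \<omega> $ l) -` B \<inter> space M | k l B. k \<in> {1..n} \<and> B \<in> sets borel} \<subseteq> sets M"
    by auto
qed

lemma F_sigma_finite: "sigma_finite_subalgebra M (F n)"
  by (intro finite_measure_subalgebra_is_sigma_finite finite_measure_subalgebra.intro
      finite_measure_axioms finite_measure_subalgebra_axioms.intro F_subalg)

lemma X_component_F:
  assumes "1 \<le> k" "k \<le> n"
  shows "(\<lambda>\<omega>. X k \<omega> $ l) \<in> borel_measurable (F n)"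
proof (rule measurableI)
  fix B :: "real set" assume "B \<in> sets borel"
  with assms show "(\<lambda>\<omega>. X k \<omega> $ l) -` B \<inter> space (F n) \<in> sets (F n)"
    unfolding space_F sets_F by (intro sigma_sets.Basic UnI2) auto
qed auto

lemma Z0_component_F: "(\<lambda>\<omega>. Z 0 \<omega> $ l) \<in> borel_measurable (F n)"
proof (rule measurableI)
  fix B :: "real set" assume "B \<in> sets borel"
  then show "(\<lambda>\<omega>. Z 0 \<omega> $ l) -` B \<inter> space (F n) \<in> sets (F n)"
    unfolding space_F sets_F by (intro sigma_sets.Basic UnI1) auto
qed auto

lemma Z_component_F: "k \<le> n \<Longrightarrow> (\<lambda>\<omega>. Z k \<omega> $ l) \<in> borel_measurable (F n)"
proof (induction k)
  case (Suc k)
  have "(\<lambda>\<omega>. Z (Suc k) \<omega> $ l) \<in> borel_measurable (F n) \<longleftrightarrow>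
      (\<lambda>\<omega>. (1 - r k) * Z k \<omega> $ l + r k * X (Suc k) \<omega> $ l) \<in> borel_measurable (F n)"
    by (rule measurable_cong) (simp add: space_F Z_Suc)
  moreover have "(\<lambda>\<omega>. (1 - r k) * Z k \<omega> $ l + r k * X (Suc k) \<omega> $ l) \<in> borel_measurable (F n)"
    using Suc X_component_F[of "Suc k" n l]
    by (intro borel_measurable_add borel_measurable_times borel_measurable_const) auto
  ultimately show ?case by blast
qed (simp add: Z0_component_F)

lemma Z_range: "\<omega> \<in> space M \<Longrightarrow> Z n \<omega> $ l \<in> {0..1}"
proof (induction n)
  case (Suc n)
  have "0 \<le> (1 - r n) * Z n \<omega> $ l + r n * X (Suc n) \<omega> $ l"
    using Suc X_range[of \<omega> n l] r_bounds[of n] by auto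
  moreover have "(1 - r n) * Z n \<omega> $ l + r n * X (Suc n) \<omega> $ l \<le> (1 - r n) * 1 + r n * 1"
    using Suc X_range[of \<omega> n l] r_bounds[of n] by (intro add_mono mult_left_mono) auto
  ultimately show ?case by (simp add: Z_Suc Suc.prems)
qed (simp add: Z0_range del: atLeastAtMost_iff)

lemma p_range: "\<omega> \<in> space M \<Longrightarrow> p n l \<omega> \<in> {0..1}"
proof -
  assume w: "\<omega> \<in> space M"
  have "p n l \<omega> \<le> (\<Sum>j\<in>UNIV. P $ l $ j * 1)"
    unfolding p_def Pv_nth using Z_range[OF w] P_nonneg by (intro sum_mono mult_left_mono) auto
  moreover have "0 \<le> p n l \<omega>"
    unfolding p_def Pv_nth using Z_range[OF w] P_nonneg by (intro sum_nonneg mult_nonneg_nonneg) auto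
  ultimately show ?thesis using row_sum_1[OF P_one] by simp
qed

lemma bm_Z [bm_intros]:
  assumes "k \<le> n"
  shows "bounded_measurable M (F n) (\<lambda>\<omega>. Z k \<omega> $ l)"
proof (rule bounded_measurableI[where B = 1])
  show "\<bar>Z k \<omega> $ l\<bar> \<le> 1" if "\<omega> \<in> space M" for \<omega>
    using Z_range[OF that, of k l] by auto
qed (rule Z_component_F[OF assms])

lemma bm_p [bm_intros]: "bounded_measurable M (F n) (p n l)"
proof -
  have "p n l = (\<lambda>\<omega>. \<Sum>j\<in>UNIV. P $ l $ j * Z n \<omega> $ j)"
    by (simp add: fun_eq_iff p_def Pv_nth)
  then show ?thesis by (auto intro!: bm_intros)
qed

lemma bm_X: "bounded_measurable M M (\<lambda>\<omega>. X (Suc n) \<omega> $ l)"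
proof (rule bounded_measurableI[where B = 1])
  show "\<bar>X (Suc n) \<omega> $ l\<bar> \<le> 1" if "\<omega> \<in> space M" for \<omega>
    using X_range[OF that, of n l] by auto
qed (rule X_component_M)

lemma bm_M: "bounded_measurable M (F n) f \<Longrightarrow> bounded_measurable M M f"
  unfolding bounded_measurable_def using measurable_from_subalg[OF F_subalg] by blast

lemma bm_linear:
  fixes f :: "real ^ 'n \<Rightarrow> real"
  assumes "linear f" "\<And>l. bounded_measurable M N (\<lambda>\<omega>. g \<omega> $ l)"
  shows "bounded_measurable M N (\<lambda>\<omega>. f (g \<omega>))"
  unfolding linear_expansion[OF assms(1), of "g _"] by (intro bm_intros assms(2))

lemma bm_drift_Z: "bounded_measurable M (F n) (\<lambda>\<omega>. drift c (Z n \<omega>) $ l)"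
proof -
  have "(\<lambda>\<omega>. drift c (Z n \<omega>) $ l) = (\<lambda>\<omega>. (1 - c) * Z n \<omega> $ l + c * p n l \<omega>)"
    by (simp add: drift_def p_def)
  then show ?thesis by (auto intro!: bm_intros)
qed

lemma bm_integrable: "bounded_measurable M M f \<Longrightarrow> integrable M f"
  unfolding bounded_measurable_def using integrable_const_bound[of f] by auto

text \<open>A \<open>{0, 1}\<close>-valued coordinate is the indicator of the event that it equals
  1, whose conditional probability is \<open>p n l\<close>. Testing against \<open>Y\<close> turns
  conditional statements into plain integrals.\<close>

lemma expectation_X:
  assumes "bounded_measurable M (F n) Y"
  shows "(\<integral>\<omega>. Y \<omega> * X (Suc n) \<omega> $ l \<partial>M) = (\<integral>\<omega>. Y \<omega> * p n l \<omega> \<partial>M)"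
proof -
  let ?A = "{\<omega>\<in>space M. X (Suc n) \<omega> $ l = 1}"
  have A: "?A \<in> sets M" using X_component_M[of n l] by measurable
  have bmA: "bounded_measurable M M (indicator ?A)"
    using A by (intro bounded_measurableI[of _ _ _ 1]) (auto simp: indicator_def)
  have eq: "X (Suc n) \<omega> $ l = indicator ?A \<omega>" if "\<omega> \<in> space M" for \<omega>
    using X_range[OF that, of n l] that by (auto simp: indicator_def)
  have "(\<integral>\<omega>. Y \<omega> * X (Suc n) \<omega> $ l \<partial>M) = (\<integral>\<omega>. Y \<omega> * indicator ?A \<omega> \<partial>M)"
    by (intro Bochner_Integration.integral_cong refl arg_cong[where f = "times (Y _)"] eq)
  also have "\<dots> = (\<integral>\<omega>. Y \<omega> * real_cond_exp M (F n) (indicator ?A) \<omega> \<partial>M)"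
    using assms A
    by (intro sigma_finite_subalgebra.real_cond_exp_intg(2)[OF F_sigma_finite, symmetric] bm_integrable
        bounded_measurable_mult bmA bm_M[OF assms]) (auto simp: bounded_measurable_def)
  also have "\<dots> = (\<integral>\<omega>. Y \<omega> * p n l \<omega> \<partial>M)"
    using X_mean[of n l] assms bm_p[of n l]
    by (intro integral_cong_AE) (auto simp: cond_prob_sigma_def p_def[symmetric] bounded_measurable_def
        intro!: borel_measurable_times measurable_from_subalg[OF F_subalg])
  finally show ?thesis .
qed

text \<open>The product of two coordinates is the indicator of an intersection, which conditional
  independence for the pair \<open>{l, m}\<close> factorizes.\<close>

lemma expectation_X_X:
  assumes "bounded_measurable M (F n) Y" "l \<noteq> m"
  shows "(\<integral>\<omega>. Y \<omega> * (X (Suc n) \<omega> $ l * X (Suc n) \<omega> $ m) \<partial>M) = (\<integral>\<omega>. Y \<omega> * (p n l \<omega> * p n m \<omega>) \<partial>M)"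
proof -
  let ?A = "\<lambda>l. {\<omega>\<in>space M. X (Suc n) \<omega> $ l = 1}"
  have vim: "(\<lambda>\<omega>. X (Suc n) \<omega> $ l) -` {1} \<inter> space M = ?A l" for l by auto
  have Al: "?A l \<in> sets M" for l using X_component_M[of n l] by measurable
  then have A: "?A l \<inter> ?A m \<in> sets M" by blast
  have bmA: "bounded_measurable M M (indicator (?A l \<inter> ?A m))"
    using A by (intro bounded_measurableI[of _ _ _ 1]) (auto simp: indicator_def)
  have eq: "X (Suc n) \<omega> $ l * X (Suc n) \<omega> $ m = indicator (?A l \<inter> ?A m) \<omega>" if "\<omega> \<in> space M" for \<omega>
    using X_range[OF that, of n l] X_range[OF that, of n m] that by (auto simp: indicator_def)
  have "AE \<omega> in M. cond_prob_sigma M (F n) (\<Inter>j\<in>{l, m}. (\<lambda>\<omega>. X (Suc n) \<omega> $ j) -` {1} \<inter> space M) \<omega> =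
      (\<Prod>j\<in>{l, m}. cond_prob_sigma M (F n) ((\<lambda>\<omega>. X (Suc n) \<omega> $ j) -` {1} \<inter> space M) \<omega>)"
    using X_indep[of n] unfolding cond_indep_vars_def
    by (elim conjE allE[of _ "{l, m}"] ballE[of _ _ "\<lambda>_. {1}"]) auto
  then have "AE \<omega> in M. cond_prob_sigma M (F n) (?A l \<inter> ?A m) \<omega> = p n l \<omega> * p n m \<omega>"
    using X_mean[of n l] X_mean[of n m] unfolding vim by eventually_elim (use assms(2) in \<open>simp add: p_def\<close>)
  then have ae: "AE \<omega> in M. real_cond_exp M (F n) (indicator (?A l \<inter> ?A m)) \<omega> = p n l \<omega> * p n m \<omega>"
    by (simp add: cond_prob_sigma_def)
  have "(\<integral>\<omega>. Y \<omega> * (X (Suc n) \<omega> $ l * X (Suc n) \<omega> $ m) \<partial>M) = (\<integral>\<omega>. Y \<omega> * indicator (?A l \<inter> ?A m) \<omega> \<partial>M)"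
    by (intro Bochner_Integration.integral_cong refl arg_cong[where f = "times (Y _)"] eq)
  also have "\<dots> = (\<integral>\<omega>. Y \<omega> * real_cond_exp M (F n) (indicator (?A l \<inter> ?A m)) \<omega> \<partial>M)"
    using assms(1) A
    by (intro sigma_finite_subalgebra.real_cond_exp_intg(2)[OF F_sigma_finite, symmetric] bm_integrable
        bounded_measurable_mult bmA bm_M[OF assms(1)]) (auto simp: bounded_measurable_def)
  also have "\<dots> = (\<integral>\<omega>. Y \<omega> * (p n l \<omega> * p n m \<omega>) \<partial>M)"
    using ae assms(1) bm_p[of n l] bm_p[of n m]
    by (intro integral_cong_AE) (auto simp: bounded_measurable_def
        intro!: borel_measurable_times measurable_from_subalg[OF F_subalg])
  finally show ?thesis .
qed

text \<open>The conditional variance of \<open>X (Suc n) \<omega> $ l\<close>, integrated with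
  weight \<open>Y\<close>.\<close>

definition noise :: "nat \<Rightarrow> ('a \<Rightarrow> real) \<Rightarrow> 'n \<Rightarrow> real" where
  "noise n Y l = (\<integral>\<omega>. Y \<omega> * (p n l \<omega> * (1 - p n l \<omega>)) \<partial>M)"

lemma expectation_fluctuation:
  assumes Y: "bounded_measurable M (F n) Y"
  shows "(\<integral>\<omega>. Y \<omega> * (X (Suc n) \<omega> $ l - p n l \<omega>) \<partial>M) = 0"
proof -
  have "(\<integral>\<omega>. Y \<omega> * (X (Suc n) \<omega> $ l - p n l \<omega>) \<partial>M) =
      (\<integral>\<omega>. Y \<omega> * X (Suc n) \<omega> $ l \<partial>M) - (\<integral>\<omega>. Y \<omega> * p n l \<omega> \<partial>M)"
    unfolding right_diff_distrib using Y bm_p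
    by (intro Bochner_Integration.integral_diff bm_integrable bounded_measurable_mult bm_X bm_M) auto
  then show ?thesis using expectation_X[OF Y] by simp
qed

text \<open>The conditional covariance matrix is diagonal: independence removes the off-diagonal
  entries, and on the diagonal the square of a \<open>{0, 1}\<close>-valued variable is
  itself.\<close>

lemma expectation_fluctuation2:
  assumes Y: "bounded_measurable M (F n) Y"
  shows "(\<integral>\<omega>. Y \<omega> * ((X (Suc n) \<omega> $ l - p n l \<omega>) * (X (Suc n) \<omega> $ m - p n m \<omega>)) \<partial>M) =
    (if l = m then noise n Y l else 0)"
proof -
  note bm = bm_integrable bounded_measurable_diff bounded_measurable_mult bm_X bm_M[OF Y] bm_M[OF bm_p]
  have Yp: "bounded_measurable M (F n) (\<lambda>\<omega>. Y \<omega> * p n m \<omega>)" for m by (intro bm_intros Y)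
  \<comment> \<open>Expanded so that the last term is a single fluctuation with a weight known at
    time \<open>n\<close>, hence of integral zero.\<close>
  have "(\<integral>\<omega>. Y \<omega> * ((X (Suc n) \<omega> $ l - p n l \<omega>) * (X (Suc n) \<omega> $ m - p n m \<omega>)) \<partial>M) =
     (\<integral>\<omega>. Y \<omega> * (X (Suc n) \<omega> $ l * X (Suc n) \<omega> $ m) - Y \<omega> * p n m \<omega> * X (Suc n) \<omega> $ l
        - Y \<omega> * p n l \<omega> * (X (Suc n) \<omega> $ m - p n m \<omega>) \<partial>M)"
    by (intro Bochner_Integration.integral_cong) (simp_all add: algebra_simps)
  also have "\<dots> = (\<integral>\<omega>. Y \<omega> * (X (Suc n) \<omega> $ l * X (Suc n) \<omega> $ m) \<partial>M)
      - (\<integral>\<omega>. Y \<omega> * p n m \<omega> * X (Suc n) \<omega> $ l \<partial>M)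
      - (\<integral>\<omega>. Y \<omega> * p n l \<omega> * (X (Suc n) \<omega> $ m - p n m \<omega>) \<partial>M)"
    by (simp add: Bochner_Integration.integral_diff bm)
  also have "\<dots> = (\<integral>\<omega>. Y \<omega> * (X (Suc n) \<omega> $ l * X (Suc n) \<omega> $ m) \<partial>M) - (\<integral>\<omega>. Y \<omega> * p n m \<omega> * p n l \<omega> \<partial>M)"
    unfolding expectation_fluctuation[OF Yp] expectation_X[OF Yp] by simp
  also have "\<dots> = (if l = m then noise n Y l else 0)"
  proof (cases "l = m")
    case True
    have "(\<integral>\<omega>. Y \<omega> * (X (Suc n) \<omega> $ l * X (Suc n) \<omega> $ l) \<partial>M) = (\<integral>\<omega>. Y \<omega> * X (Suc n) \<omega> $ l \<partial>M)"
    proof (rule Bochner_Integration.integral_cong)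
      fix \<omega> assume "\<omega> \<in> space M"
      then show "Y \<omega> * (X (Suc n) \<omega> $ l * X (Suc n) \<omega> $ l) = Y \<omega> * X (Suc n) \<omega> $ l"
        using X_range[of \<omega> n l] by auto
    qed simp
    moreover have "noise n Y l = (\<integral>\<omega>. Y \<omega> * p n l \<omega> - Y \<omega> * p n l \<omega> * p n l \<omega> \<partial>M)"
      unfolding noise_def by (simp add: algebra_simps)
    moreover have "\<dots> = (\<integral>\<omega>. Y \<omega> * p n l \<omega> \<partial>M) - (\<integral>\<omega>. Y \<omega> * p n l \<omega> * p n l \<omega> \<partial>M)"
      by (intro Bochner_Integration.integral_diff bm)
    ultimately show ?thesis using True expectation_X[OF Y] by simp
  next
    case False
    then show ?thesis using expectation_X_X[OF Y False] by (simp add: ac_simps)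
  qed
  finally show ?thesis .
qed

text \<open>The new state is the drift plus \<open>r n\<close> times a fluctuation; cross terms
  integrate to zero and only diagonal covariances remain. The weight \<open>Y\<close> admits
  indicators of past events, the center \<open>c\<close> a value known at time
  \<open>n\<close>.\<close>

lemma second_moment_step:
  assumes Y: "bounded_measurable M (F n) Y" and c: "bounded_measurable M (F n) c" and lin: "linear f"
  shows "(\<integral>\<omega>. Y \<omega> * (f (Z (Suc n) \<omega>) - c \<omega>)\<^sup>2 \<partial>M) =
    (\<integral>\<omega>. Y \<omega> * (f (drift (r n) (Z n \<omega>)) - c \<omega>)\<^sup>2 \<partial>M) + (r n)\<^sup>2 * (\<Sum>l\<in>UNIV. (f (axis l 1))\<^sup>2 * noise n Y l)"
proof -
  define \<alpha> where "\<alpha> l = f (axis l 1)" for l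
  define \<xi> where "\<xi> l \<omega> = X (Suc n) \<omega> $ l - p n l \<omega>" for l \<omega>
  define u where "u \<omega> = f (drift (r n) (Z n \<omega>)) - c \<omega>" for \<omega>
  have bmu: "bounded_measurable M (F n) u"
    unfolding u_def by (intro bm_intros bm_linear[OF lin bm_drift_Z] c)
  then have Yu: "bounded_measurable M (F n) (\<lambda>\<omega>. Y \<omega> * u \<omega>)" by (intro bm_intros Y)
  have bm\<xi>: "bounded_measurable M M (\<xi> l)" for l
    unfolding \<xi>_def by (intro bm_intros bm_X bm_M[OF bm_p])
  note bm = bm_integrable bounded_measurable_mult bounded_measurable_const bounded_measurable_add
    bounded_measurable_sum bounded_measurable_power bm_M[OF Y] bm_M[OF bmu] bm_M[OF Yu] bm\<xi>
  have dec: "f (Z (Suc n) \<omega>) - c \<omega> = u \<omega> + r n * (\<Sum>l\<in>UNIV. \<alpha> l * \<xi> l \<omega>)" if w: "\<omega> \<in> space M" for \<omega>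
  proof -
    have "Z (Suc n) \<omega> = drift (r n) (Z n \<omega>) + r n *\<^sub>R (\<chi> l. \<xi> l \<omega>)"
      by (simp add: vec_eq_iff Z_Suc[OF w] drift_def \<xi>_def p_def algebra_simps)
    then have "f (Z (Suc n) \<omega>) = f (drift (r n) (Z n \<omega>)) + r n * f (\<chi> l. \<xi> l \<omega>)"
      using lin by (simp add: linear_add linear_cmul)
    then show ?thesis
      using linear_expansion[OF lin, of "\<chi> l. \<xi> l \<omega>"] by (simp add: u_def \<alpha>_def mult.commute)
  qed
  have "(\<integral>\<omega>. Y \<omega> * (f (Z (Suc n) \<omega>) - c \<omega>)\<^sup>2 \<partial>M) =
     (\<integral>\<omega>. Y \<omega> * (u \<omega>)\<^sup>2 + (\<Sum>l\<in>UNIV. 2 * r n * \<alpha> l * (Y \<omega> * u \<omega> * \<xi> l \<omega>))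
       + (\<Sum>l\<in>UNIV. \<Sum>m\<in>UNIV. (r n)\<^sup>2 * \<alpha> l * \<alpha> m * (Y \<omega> * (\<xi> l \<omega> * \<xi> m \<omega>))) \<partial>M)"
  proof (rule Bochner_Integration.integral_cong)
    fix \<omega> assume w: "\<omega> \<in> space M"
    let ?S = "\<Sum>l\<in>UNIV. \<alpha> l * \<xi> l \<omega>"
    have "(\<Sum>l\<in>UNIV. 2 * r n * \<alpha> l * (Y \<omega> * u \<omega> * \<xi> l \<omega>)) = 2 * r n * Y \<omega> * u \<omega> * ?S"
      by (simp add: sum_distrib_left ac_simps)
    moreover have "(\<Sum>l\<in>UNIV. \<Sum>m\<in>UNIV. (r n)\<^sup>2 * \<alpha> l * \<alpha> m * (Y \<omega> * (\<xi> l \<omega> * \<xi> m \<omega>))) = (r n)\<^sup>2 * Y \<omega> * (?S * ?S)"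
      unfolding sum_product by (simp add: sum_distrib_left ac_simps)
    ultimately show "Y \<omega> * (f (Z (Suc n) \<omega>) - c \<omega>)\<^sup>2 = Y \<omega> * (u \<omega>)\<^sup>2 + (\<Sum>l\<in>UNIV. 2 * r n * \<alpha> l * (Y \<omega> * u \<omega> * \<xi> l \<omega>))
       + (\<Sum>l\<in>UNIV. \<Sum>m\<in>UNIV. (r n)\<^sup>2 * \<alpha> l * \<alpha> m * (Y \<omega> * (\<xi> l \<omega> * \<xi> m \<omega>)))"
      unfolding dec[OF w] by (simp add: power2_eq_square algebra_simps)
  qed simp
  also have "\<dots> = (\<integral>\<omega>. Y \<omega> * (u \<omega>)\<^sup>2 \<partial>M) + (\<Sum>l\<in>UNIV. 2 * r n * \<alpha> l * (\<integral>\<omega>. Y \<omega> * u \<omega> * \<xi> l \<omega> \<partial>M))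
       + (\<Sum>l\<in>UNIV. \<Sum>m\<in>UNIV. (r n)\<^sup>2 * \<alpha> l * \<alpha> m * (\<integral>\<omega>. Y \<omega> * (\<xi> l \<omega> * \<xi> m \<omega>) \<partial>M))"
    by (simp add: Bochner_Integration.integral_add Bochner_Integration.integral_sum bm)
  also have "\<dots> = (\<integral>\<omega>. Y \<omega> * (u \<omega>)\<^sup>2 \<partial>M) + (\<Sum>l\<in>UNIV. (r n)\<^sup>2 * (\<alpha> l)\<^sup>2 * noise n Y l)"
    unfolding \<xi>_def expectation_fluctuation[OF Yu] expectation_fluctuation2[OF Y]
    by (simp add: if_distrib power2_eq_square mult.assoc cong: if_cong)
  finally show ?thesis by (simp add: u_def \<alpha>_def sum_distrib_left mult.assoc)
qed

end

section \<open>Synchronization\<close>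

text \<open>Doob's argument for a supermartingale up to summable errors: freeze the process at
  height \<open>c\<close> once it has reached \<open>c\<close>. On \<open>N k\<close> the level has
  not been reached up to time \<open>k\<close>.\<close>

lemma (in prob_space) supermartingale_maximal_inequality:
  fixes U :: "nat \<Rightarrow> 'a \<Rightarrow> real" and e :: "nat \<Rightarrow> real" and c :: real
  defines "N \<equiv> \<lambda>k. {\<omega>\<in>space M. \<forall>j\<le>k. U j \<omega> < c}"
  assumes int: "\<And>k. integrable M (U k)" and nn: "\<And>k \<omega>. \<omega> \<in> space M \<Longrightarrow> U k \<omega> \<ge> 0" and c: "c > 0"
    and e: "\<And>k. e k \<ge> 0" "summable e"
    and step: "\<And>k. (\<integral>\<omega>. indicator (N k) \<omega> * U (Suc k) \<omega> \<partial>M) \<le> (\<integral>\<omega>. indicator (N k) \<omega> * U k \<omega> \<partial>M) + e k"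
  shows "c * prob {\<omega>\<in>space M. \<exists>k. U k \<omega> \<ge> c} \<le> (\<integral>\<omega>. U 0 \<omega> \<partial>M) + (\<Sum>k. e k)"
proof -
  have [measurable]: "U k \<in> borel_measurable M" for k using int by auto
  have N[measurable]: "N k \<in> sets M" for k unfolding N_def by measurable
  define S where "S = (\<integral>\<omega>. U 0 \<omega> \<partial>M) + (\<Sum>k. e k)"
  \<comment> \<open>The process frozen at \<open>c\<close>; its mean grows by at most
    \<open>e k\<close> in step \<open>k\<close> and dominates \<open>c\<close> times the probability
    of having reached \<open>c\<close>.\<close>
  define g where "g k \<omega> = c * indicator (space M - N k) \<omega> + indicator (N k) \<omega> * U k \<omega>" for k \<omega>
  have intN: "integrable M (\<lambda>\<omega>. indicator (N k) \<omega> * U j \<omega>)" for k j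
    using integrable_mult_indicator[OF N int] by simp
  have intc: "integrable M (\<lambda>\<omega>. c * indicator (space M - N k) \<omega>)" for k
    by (intro integrable_mult_right integrable_real_indicator) (auto simp: emeasure_eq_measure)
  have intg: "(\<integral>\<omega>. c * indicator (space M - N k) \<omega> + indicator (N k) \<omega> * U j \<omega> \<partial>M) =
      (\<integral>\<omega>. c * indicator (space M - N k) \<omega> \<partial>M) + (\<integral>\<omega>. indicator (N k) \<omega> * U j \<omega> \<partial>M)" for k j
    by (intro Bochner_Integration.integral_add intN intc)
  have g: "(\<integral>\<omega>. g k \<omega> \<partial>M) \<le> (\<integral>\<omega>. U 0 \<omega> \<partial>M) + (\<Sum>j<k. e j)" for k
  proof (induction k)
    case 0
    have "(\<integral>\<omega>. g 0 \<omega> \<partial>M) \<le> (\<integral>\<omega>. U 0 \<omega> \<partial>M)"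
      unfolding g_def by (intro integral_mono Bochner_Integration.integrable_add intN intc int)
        (auto simp: N_def indicator_def not_less)
    then show ?case by simp
  next
    case (Suc k)
    have "(\<integral>\<omega>. g (Suc k) \<omega> \<partial>M) \<le> (\<integral>\<omega>. c * indicator (space M - N k) \<omega> + indicator (N k) \<omega> * U (Suc k) \<omega> \<partial>M)"
      unfolding g_def
    proof (intro integral_mono Bochner_Integration.integrable_add intN intc)
      fix \<omega> assume w: "\<omega> \<in> space M"
      \<comment> \<open>A path that leaves \<open>N k\<close> at time \<open>Suc k\<close> has value
        at least \<open>c\<close> there, so freezing it at \<open>c\<close> does not increase the
        integrand.\<close>
      have "\<omega> \<in> N (Suc k) \<longleftrightarrow> \<omega> \<in> N k \<and> U (Suc k) \<omega> < c"
        by (auto simp: N_def le_Suc_eq)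
      then show "c * indicator (space M - N (Suc k)) \<omega> + indicator (N (Suc k)) \<omega> * U (Suc k) \<omega> \<le>
          c * indicator (space M - N k) \<omega> + indicator (N k) \<omega> * U (Suc k) \<omega>"
        using w by (auto simp: indicator_def)
    qed
    also have "\<dots> \<le> (\<integral>\<omega>. g k \<omega> \<partial>M) + e k" using step[of k] unfolding g_def intg by simp
    finally show ?case using Suc by simp
  qed
  have "c * prob (space M - N k) \<le> S" for k
  proof -
    have "c * prob (space M - N k) = (\<integral>\<omega>. c * indicator (space M - N k) \<omega> \<partial>M)" by simp
    also have "\<dots> \<le> (\<integral>\<omega>. g k \<omega> \<partial>M)"
      unfolding g_def by (intro integral_mono Bochner_Integration.integrable_add intN intc)
        (auto simp: indicator_def nn)
    also have "\<dots> \<le> S" unfolding S_def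
      using g[of k] sum_le_suminf[OF e(2), of "{..<k}"] e(1) by (simp add: order_trans)
    finally show ?thesis .
  qed
  moreover have "(\<lambda>k. c * prob (space M - N k)) \<longlonglongrightarrow> c * prob (\<Union>k. space M - N k)"
    by (intro tendsto_mult_left finite_Lim_measure_incseq incseq_SucI) (auto simp: N_def)
  ultimately have "c * prob (\<Union>k. space M - N k) \<le> S"
    by (intro LIMSEQ_le_const2[of _ _ S]) auto
  moreover have "(\<Union>k. space M - N k) = {\<omega>\<in>space M. \<exists>k. U k \<omega> \<ge> c}"
    unfolding N_def using not_less by blast
  ultimately show ?thesis by (simp add: S_def)
qed

section \<open>Summable noise, decay of the mean energy and uniform deviations\<close>

context reinforced_process begin

lemma noise_nonneg:
  assumes "\<And>\<omega>. \<omega> \<in> space M \<Longrightarrow> Y \<omega> \<ge> 0"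
  shows "noise n Y l \<ge> 0"
  unfolding noise_def using assms p_range by (intro Bochner_Integration.integral_nonneg) auto

lemma noise_le_noise_1:
  assumes "bounded_measurable M (F n) Y" "\<And>\<omega>. \<omega> \<in> space M \<Longrightarrow> Y \<omega> \<le> 1"
  shows "noise n Y l \<le> noise n (\<lambda>_. 1) l"
  unfolding noise_def
proof (rule integral_mono)
  show "integrable M (\<lambda>\<omega>. Y \<omega> * (p n l \<omega> * (1 - p n l \<omega>)))"
    "integrable M (\<lambda>\<omega>. 1 * (p n l \<omega> * (1 - p n l \<omega>)))"
    by (intro bm_integrable bm_intros bm_M[OF assms(1)] bm_M[OF bm_p])+
  fix \<omega> assume w: "\<omega> \<in> space M"
  show "Y \<omega> * (p n l \<omega> * (1 - p n l \<omega>)) \<le> 1 * (p n l \<omega> * (1 - p n l \<omega>))"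
    using p_range[OF w, of n l] assms(2)[OF w] by (intro mult_right_mono) auto
qed

text \<open>The mean of \<open>msq\<close> added by the fluctuation of one step; the weight
  \<open>\<pi> $ l\<close> is the \<open>msq\<close> of the unit vector
  \<open>axis l 1\<close>.\<close>

definition err :: "nat \<Rightarrow> real" where
  "err n = (r n)\<^sup>2 * (\<Sum>l\<in>UNIV. \<pi> $ l * noise n (\<lambda>_. 1) l)"

lemma err_nonneg: "err n \<ge> 0"
  unfolding err_def using pi_pos by (intro mult_nonneg_nonneg sum_nonneg noise_nonneg) (auto simp: less_imp_le)

lemma bm_msq:
  assumes "\<And>i. bounded_measurable M N (\<lambda>\<omega>. g \<omega> $ i)"
  shows "bounded_measurable M N (\<lambda>\<omega>. msq (g \<omega>))"
  unfolding msq_def by (intro bm_intros assms)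

lemma pi_inner_Z_range:
  assumes "\<omega> \<in> space M"
  shows "\<pi> \<bullet> Z n \<omega> \<in> {0..1}"
proof -
  have "\<pi> \<bullet> Z n \<omega> \<le> (\<Sum>i\<in>UNIV. \<pi> $ i * 1)"
    unfolding inner_vec_def inner_real_def using Z_range[OF assms] pi_pos
    by (intro sum_mono mult_left_mono) (auto simp: less_imp_le)
  moreover have "0 \<le> \<pi> \<bullet> Z n \<omega>"
    unfolding inner_vec_def inner_real_def using Z_range[OF assms] pi_pos
    by (intro sum_nonneg mult_nonneg_nonneg) (auto simp: less_imp_le)
  ultimately show ?thesis by (simp add: pi_sum)
qed

lemma bm_pi_inner_Z: "k \<le> n \<Longrightarrow> bounded_measurable M (F n) (\<lambda>\<omega>. \<pi> \<bullet> Z k \<omega>)"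
  unfolding inner_vec_def inner_real_def by (intro bm_intros)

lemma pi_lower_bound: "\<exists>\<kappa>>0. \<forall>l. \<kappa> \<le> \<pi> $ l"
proof -
  have "Min (range (\<lambda>l. \<pi> $ l)) > 0" using pi_pos by (subst Min_gr_iff) auto
  then show ?thesis by (intro exI[of _ "Min (range (\<lambda>l. \<pi> $ l))"]) auto
qed

text \<open>The bounded martingale \<open>\<pi> \<bullet> Z n\<close> accumulates the noise, which is therefore summable.\<close>

lemma summable_err: "summable err"
proof -
  \<comment> \<open>The increment of the second moment of \<open>\<pi> \<bullet> Z n\<close>. The
    functional \<open>\<pi> \<bullet> x\<close> maps \<open>axis l 1\<close> to
    \<open>\<pi> $ l\<close>, so the weights are squared here; a lower bound \<open>\<kappa>\<close>
    for \<open>\<pi>\<close> later trades them for those in \<open>err\<close>.\<close>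
  define q where "q n = (r n)\<^sup>2 * (\<Sum>l\<in>UNIV. (\<pi> $ l)\<^sup>2 * noise n (\<lambda>_. 1) l)" for n
  have q: "q n = (\<integral>\<omega>. (\<pi> \<bullet> Z (Suc n) \<omega>)\<^sup>2 \<partial>M) - (\<integral>\<omega>. (\<pi> \<bullet> Z n \<omega>)\<^sup>2 \<partial>M)" for n
    using second_moment_step[where n = n and Y = "\<lambda>_. 1" and c = "\<lambda>_. 0" and f = "\<lambda>x. \<pi> \<bullet> x",
        OF bounded_measurable_const bounded_measurable_const bounded_linear.linear[OF bounded_linear_inner_right]]
    by (simp add: q_def pi_inner_drift inner_axis)
  have "sum q {..<n} \<le> 1" for n
  proof -
    have "sum q {..<n} = (\<integral>\<omega>. (\<pi> \<bullet> Z n \<omega>)\<^sup>2 \<partial>M) - (\<integral>\<omega>. (\<pi> \<bullet> Z 0 \<omega>)\<^sup>2 \<partial>M)"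
      unfolding q by (rule sum_lessThan_telescope)
    also have "\<dots> \<le> (\<integral>\<omega>. (\<pi> \<bullet> Z n \<omega>)\<^sup>2 \<partial>M)" by simp
    also have "\<dots> \<le> (\<integral>\<omega>. 1 \<partial>M)"
    proof (rule integral_mono)
      show "integrable M (\<lambda>\<omega>. (\<pi> \<bullet> Z n \<omega>)\<^sup>2)"
        by (intro bm_integrable bm_intros bm_M[OF bm_pi_inner_Z[of n n]]) simp
      show "(\<pi> \<bullet> Z n \<omega>)\<^sup>2 \<le> 1" if "\<omega> \<in> space M" for \<omega>
        using pi_inner_Z_range[OF that, of n] by (intro power_le_one) auto
    qed simp
    finally show ?thesis by (simp add: prob_space)
  qed
  moreover have "q n \<ge> 0" for n unfolding q_def by (intro mult_nonneg_nonneg sum_nonneg noise_nonneg) auto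
  ultimately have sq: "summable q" by (intro summableI_nonneg_bounded)
  obtain \<kappa> where k: "\<kappa> > 0" "\<And>l. \<kappa> \<le> \<pi> $ l" using pi_lower_bound by blast
  have "err n \<le> 1 / \<kappa> * q n" for n
  proof -
    have "\<kappa> * err n = (r n)\<^sup>2 * (\<Sum>l\<in>UNIV. \<kappa> * \<pi> $ l * noise n (\<lambda>_. 1) l)"
      by (simp add: err_def sum_distrib_left ac_simps)
    also have "\<dots> \<le> q n" unfolding q_def power2_eq_square[of "\<pi> $ _"]
      using k pi_pos by (intro mult_left_mono sum_mono mult_right_mono noise_nonneg) (auto simp: less_imp_le)
    finally show ?thesis using k(1) by (simp add: field_simps)
  qed
  then show ?thesis
    using summable_comparison_test'[OF summable_mult[OF sq, of "1 / \<kappa>"], of 0 err] err_nonneg by auto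
qed

text \<open>The scalar moment identity for each coordinate of \<open>T\<close>, summed with the
  weights \<open>\<pi>\<close>.\<close>

lemma msq_step:
  assumes Y: "bounded_measurable M (F n) Y" and c: "bounded_measurable M (F n) c" and lin: "linear T"
  shows "(\<integral>\<omega>. Y \<omega> * msq (T (Z (Suc n) \<omega>) - c \<omega> *\<^sub>R 1) \<partial>M) =
    (\<integral>\<omega>. Y \<omega> * msq (T (drift (r n) (Z n \<omega>)) - c \<omega> *\<^sub>R 1) \<partial>M) + (r n)\<^sup>2 * (\<Sum>l\<in>UNIV. msq (T (axis l 1)) * noise n Y l)"
proof -
  have linf: "linear (\<lambda>x. T x $ i)" for i
    using lin by (auto intro!: linearI simp: linear_add linear_cmul)
  note bmf = bm_linear[OF linf]
  have Zc: "bounded_measurable M M (\<lambda>\<omega>. Z (Suc n) \<omega> $ l)" for l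
    using bm_M[OF bm_Z[of "Suc n" "Suc n"]] by simp
  have I: "(\<integral>\<omega>. Y \<omega> * msq (T (g \<omega>) - c \<omega> *\<^sub>R 1) \<partial>M) = (\<Sum>i\<in>UNIV. \<pi> $ i * (\<integral>\<omega>. Y \<omega> * (T (g \<omega>) $ i - c \<omega>)\<^sup>2 \<partial>M))"
    if "\<And>l. bounded_measurable M M (\<lambda>\<omega>. g \<omega> $ l)" for g
  proof -
    have "(\<integral>\<omega>. Y \<omega> * msq (T (g \<omega>) - c \<omega> *\<^sub>R 1) \<partial>M) = (\<integral>\<omega>. (\<Sum>i\<in>UNIV. \<pi> $ i * (Y \<omega> * (T (g \<omega>) $ i - c \<omega>)\<^sup>2)) \<partial>M)"
      by (simp add: msq_def sum_distrib_left ac_simps)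
    also have "\<dots> = (\<Sum>i\<in>UNIV. \<integral>\<omega>. \<pi> $ i * (Y \<omega> * (T (g \<omega>) $ i - c \<omega>)\<^sup>2) \<partial>M)"
      by (intro Bochner_Integration.integral_sum bm_integrable bm_intros bm_M[OF Y] bm_M[OF c] bmf[OF that])
    finally show ?thesis by simp
  qed
  have "(\<Sum>i\<in>UNIV. \<pi> $ i * ((r n)\<^sup>2 * (\<Sum>l\<in>UNIV. (T (axis l 1) $ i)\<^sup>2 * noise n Y l))) =
     (\<Sum>i\<in>UNIV. \<Sum>l\<in>UNIV. (r n)\<^sup>2 * (\<pi> $ i * (T (axis l 1) $ i)\<^sup>2 * noise n Y l))"
    by (simp add: sum_distrib_left ac_simps)
  also have "\<dots> = (\<Sum>l\<in>UNIV. \<Sum>i\<in>UNIV. (r n)\<^sup>2 * (\<pi> $ i * (T (axis l 1) $ i)\<^sup>2 * noise n Y l))"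
    by (rule sum.swap)
  also have "\<dots> = (r n)\<^sup>2 * (\<Sum>l\<in>UNIV. msq (T (axis l 1)) * noise n Y l)"
    by (simp add: msq_def sum_distrib_left sum_distrib_right)
  finally show ?thesis
    unfolding I[OF Zc] I[OF bm_M[OF bm_drift_Z]] second_moment_step[OF Y c linf]
    by (simp add: distrib_left sum.distrib)
qed

lemma msq_axis: "msq (axis l 1) = \<pi> $ l"
  by (simp add: msq_def axis_def if_distrib[where f = "\<lambda>x. _ * x\<^sup>2"] cong: if_cong)

lemma msq_center_le: "msq (center x) \<le> msq x"
  by (simp add: msq_center)

lemma r_bounds': "0 \<le> r n \<and> r n \<le> 1"
  using r_bounds[of n] by auto

text \<open>Going back from time \<open>n + k\<close> to \<open>n\<close>, each step prepends a
  drift to the flow and costs at most \<open>err\<close>, since centering and flow do not increase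
  the \<open>msq\<close> of the noise. The length \<open>m\<close> varies because the flow grows in
  the induction.\<close>

lemma energy_le_flow:
  "(\<integral>\<omega>. msq (flow r (n + k) m (center (Z (n + k) \<omega>))) \<partial>M) \<le>
    (\<integral>\<omega>. msq (flow r n (k + m) (center (Z n \<omega>))) \<partial>M) + (\<Sum>j<k. err (n + j))"
proof (induction k arbitrary: m)
  case (Suc k)
  let ?N = "n + k"
  define T where "T x = flow r (Suc ?N) m (center x)" for x
  have lin: "linear T"
    using linear_compose[OF linear_center linear_flow] unfolding T_def o_def .
  have T1: "msq (T (axis l 1)) \<le> \<pi> $ l" for l
    unfolding T_def using msq_flow_le[of r "Suc ?N" m] r_bounds' msq_center_le[of "axis l 1"]
    by (metis msq_axis order_trans)
  have "(\<integral>\<omega>. msq (T (Z (Suc ?N) \<omega>)) \<partial>M) = (\<integral>\<omega>. msq (T (drift (r ?N) (Z ?N \<omega>))) \<partial>M)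
      + (r ?N)\<^sup>2 * (\<Sum>l\<in>UNIV. msq (T (axis l 1)) * noise ?N (\<lambda>_. 1) l)"
    using msq_step[where n = ?N and Y = "\<lambda>_. 1" and c = "\<lambda>_. 0", OF bounded_measurable_const bounded_measurable_const lin]
    by simp
  also have "(r ?N)\<^sup>2 * (\<Sum>l\<in>UNIV. msq (T (axis l 1)) * noise ?N (\<lambda>_. 1) l) \<le> err ?N"
    unfolding err_def using T1 by (intro mult_left_mono sum_mono mult_right_mono noise_nonneg) auto
  also have "(\<integral>\<omega>. msq (T (drift (r ?N) (Z ?N \<omega>))) \<partial>M) = (\<integral>\<omega>. msq (flow r ?N (Suc m) (center (Z ?N \<omega>))) \<partial>M)"
    by (simp only: T_def center_drift flow_Suc_left)
  also have "\<dots> \<le> (\<integral>\<omega>. msq (flow r n (k + Suc m) (center (Z n \<omega>))) \<partial>M) + (\<Sum>j<k. err (n + j))"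
    by (rule Suc)
  finally show ?case by (simp add: T_def)
qed simp

text \<open>First fix \<open>n\<close> with a small tail of \<open>err\<close>, then let the flow
  started at \<open>n\<close> run; its mean energy vanishes by dominated convergence.\<close>

lemma energy_tendsto_0:
  assumes flow: "\<And>n x. \<pi> \<bullet> x = 0 \<Longrightarrow> (\<lambda>m. msq (flow r n m x)) \<longlonglongrightarrow> 0"
  shows "(\<lambda>n. \<integral>\<omega>. msq (center (Z n \<omega>)) \<partial>M) \<longlonglongrightarrow> 0"
proof (rule LIMSEQ_I)
  fix \<epsilon> :: real assume eps: "\<epsilon> > 0"
  have lin: "linear (\<lambda>x. flow r n m (center x) $ i)" for n m i
    by (rule linearI) (simp_all add: linear_add[OF linear_center] linear_add[OF linear_flow]
        linear_cmul[OF linear_center] linear_cmul[OF linear_flow])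
  have bmE: "bounded_measurable M M (\<lambda>\<omega>. msq (flow r n m (center (Z n \<omega>))))" for n m
    by (intro bm_msq bm_linear[OF lin] bm_M[OF bm_Z[of n n]]) simp
  obtain n where n: "norm (\<Sum>j. err (j + n)) < \<epsilon> / 2"
    using suminf_exist_split[OF _ summable_err, of "\<epsilon> / 2"] eps by auto
  have sn: "summable (\<lambda>j. err (n + j))" using summable_err
    by (simp add: add.commute summable_iff_shift)
  have tail: "(\<Sum>j<k. err (n + j)) < \<epsilon> / 2" for k
  proof -
    have "(\<Sum>j<k. err (n + j)) \<le> (\<Sum>j. err (n + j))"
      by (rule sum_le_suminf[OF sn]) (auto simp: err_nonneg)
    then show ?thesis using n by (simp add: add.commute)
  qed
  have "(\<lambda>k. \<integral>\<omega>. msq (flow r n k (center (Z n \<omega>))) \<partial>M) \<longlonglongrightarrow> (\<integral>\<omega>. 0 \<partial>M)"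
  proof (rule integral_dominated_convergence)
    show "AE \<omega> in M. (\<lambda>k. msq (flow r n k (center (Z n \<omega>)))) \<longlonglongrightarrow> 0"
      by (intro AE_I2 flow pi_inner_center)
    show "AE \<omega> in M. norm (msq (flow r n k (center (Z n \<omega>)))) \<le> msq (center (Z n \<omega>))" for k
      using msq_flow_le[of r n k] r_bounds' by (auto simp: msq_nonneg)
    show "(\<lambda>\<omega>. msq (flow r n k (center (Z n \<omega>)))) \<in> borel_measurable M" for k
      using bmE by (simp add: bounded_measurable_def)
    show "integrable M (\<lambda>\<omega>. msq (center (Z n \<omega>)))"
      using bm_integrable[OF bmE[of n 0]] by simp
  qed simp
  then have "eventually (\<lambda>k. (\<integral>\<omega>. msq (flow r n k (center (Z n \<omega>))) \<partial>M) < \<epsilon> / 2) sequentially"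
    using eps by (intro order_tendstoD(2)[of _ "0::real"]) simp_all
  then obtain k0 where k0: "\<And>k. k \<ge> k0 \<Longrightarrow> (\<integral>\<omega>. msq (flow r n k (center (Z n \<omega>))) \<partial>M) < \<epsilon> / 2"
    by (auto simp: eventually_sequentially)
  have "norm ((\<integral>\<omega>. msq (center (Z N \<omega>)) \<partial>M) - 0) < \<epsilon>" if "N \<ge> n + k0" for N
  proof -
    define k where "k = N - n"
    have N: "N = n + k" "k \<ge> k0" using that by (auto simp: k_def)
    have "(\<integral>\<omega>. msq (center (Z N \<omega>)) \<partial>M) < \<epsilon>"
      using energy_le_flow[where n = n and k = k and m = 0] k0[OF N(2)] tail[of k] by (simp add: N(1))
    moreover have "(\<integral>\<omega>. msq (center (Z N \<omega>)) \<partial>M) \<ge> 0"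
      by (intro Bochner_Integration.integral_nonneg) (simp add: msq_nonneg)
    ultimately show ?thesis by simp
  qed
  then show "\<exists>N0. \<forall>N\<ge>N0. norm ((\<integral>\<omega>. msq (center (Z N \<omega>)) \<partial>M) - 0) < \<epsilon>" by blast
qed

text \<open>The center \<open>\<pi> \<bullet> Z n\<close> is frozen at time \<open>n\<close>. Drifts
  fix constants and do not increase \<open>msq\<close>, so the deviations form a supermartingale up
  to the errors \<open>err (n + k)\<close>.\<close>

lemma deviation_probability:
  assumes "c > 0"
  shows "c * prob {\<omega>\<in>space M. \<exists>k. msq (Z (n + k) \<omega> - (\<pi> \<bullet> Z n \<omega>) *\<^sub>R 1) \<ge> c} \<le>
    (\<integral>\<omega>. msq (center (Z n \<omega>)) \<partial>M) + (\<Sum>k. err (n + k))"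
proof -
  define U where "U k \<omega> = msq (Z (n + k) \<omega> - (\<pi> \<bullet> Z n \<omega>) *\<^sub>R 1)" for k \<omega>
  have bmU: "bounded_measurable M (F (n + k)) (U j)" if "j \<le> k" for j k
    unfolding U_def using that
    by (intro bm_msq) (auto intro!: bm_intros bm_pi_inner_Z)
  have intU: "integrable M (U k)" for k by (rule bm_integrable[OF bm_M[OF bmU[OF order_refl]]])
  have "c * prob {\<omega>\<in>space M. \<exists>k. U k \<omega> \<ge> c} \<le> (\<integral>\<omega>. U 0 \<omega> \<partial>M) + (\<Sum>k. err (n + k))"
  proof (rule supermartingale_maximal_inequality[OF intU _ assms err_nonneg])
    show "summable (\<lambda>k. err (n + k))" using summable_err
      by (simp add: add.commute summable_iff_shift)
    fix k
    let ?N = "{\<omega>\<in>space M. \<forall>j\<le>k. U j \<omega> < c}"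
    let ?Y = "\<lambda>\<omega>. indicator ?N \<omega> :: real"
    have [measurable]: "U j \<in> borel_measurable (F (n + k))" if "j \<le> k" for j
      using bmU[OF that] by (simp add: bounded_measurable_def)
    \<comment> \<open>The event of no crossing so far belongs to \<open>F (n + k)\<close>, so its
      indicator is an admissible weight for \<open>msq_step\<close>.\<close>
    have "{\<omega> \<in> space (F (n + k)). \<forall>j\<in>{..k}. U j \<omega> < c} \<in> sets (F (n + k))"
      by measurable
    moreover have "?N = {\<omega> \<in> space (F (n + k)). \<forall>j\<in>{..k}. U j \<omega> < c}"
      unfolding space_F by auto
    ultimately have N: "?N \<in> sets (F (n + k))" by (simp only:)
    have Y: "bounded_measurable M (F (n + k)) ?Y"
    proof (rule bounded_measurableI[where B = 1])
      show "?Y \<in> borel_measurable (F (n + k))" using N by (rule borel_measurable_indicator)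
      show "\<bar>?Y \<omega>\<bar> \<le> 1" for \<omega> by (rule indicator_abs_le_1)
    qed
    have c: "bounded_measurable M (F (n + k)) (\<lambda>\<omega>. \<pi> \<bullet> Z n \<omega>)" by (rule bm_pi_inner_Z) simp
    have "(\<integral>\<omega>. ?Y \<omega> * U (Suc k) \<omega> \<partial>M) =
       (\<integral>\<omega>. ?Y \<omega> * msq (drift (r (n + k)) (Z (n + k) \<omega>) - (\<pi> \<bullet> Z n \<omega>) *\<^sub>R 1) \<partial>M)
       + (r (n + k))\<^sup>2 * (\<Sum>l\<in>UNIV. msq (axis l 1) * noise (n + k) ?Y l)"
      using msq_step[OF Y c linear_id] by (simp add: U_def id_def)
    also have "(r (n + k))\<^sup>2 * (\<Sum>l\<in>UNIV. msq (axis l 1) * noise (n + k) ?Y l) \<le> err (n + k)"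
      unfolding err_def msq_axis using pi_pos
      by (intro mult_left_mono sum_mono noise_le_noise_1 Y) (auto simp: less_imp_le indicator_def)
    also have "(\<integral>\<omega>. ?Y \<omega> * msq (drift (r (n + k)) (Z (n + k) \<omega>) - (\<pi> \<bullet> Z n \<omega>) *\<^sub>R 1) \<partial>M) \<le> (\<integral>\<omega>. ?Y \<omega> * U k \<omega> \<partial>M)"
    proof (rule integral_mono)
      show "integrable M (\<lambda>\<omega>. ?Y \<omega> * U k \<omega>)"
        by (intro bm_integrable bm_M[of "n + k"] bm_intros Y bmU) simp
      show "integrable M (\<lambda>\<omega>. ?Y \<omega> * msq (drift (r (n + k)) (Z (n + k) \<omega>) - (\<pi> \<bullet> Z n \<omega>) *\<^sub>R 1))"
        by (intro bm_integrable bm_M[of "n + k"] bm_intros Y bm_msq) (auto intro!: bm_intros bm_drift_Z c)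
      fix \<omega>
      have "drift (r (n + k)) (Z (n + k) \<omega>) - (\<pi> \<bullet> Z n \<omega>) *\<^sub>R 1 = drift (r (n + k)) (Z (n + k) \<omega> - (\<pi> \<bullet> Z n \<omega>) *\<^sub>R 1)"
        by (simp add: linear_diff[OF linear_drift] linear_cmul[OF linear_drift] drift_one)
      then show "?Y \<omega> * msq (drift (r (n + k)) (Z (n + k) \<omega>) - (\<pi> \<bullet> Z n \<omega>) *\<^sub>R 1) \<le> ?Y \<omega> * U k \<omega>"
        unfolding U_def using r_bounds'[of "n + k"] by (auto intro!: mult_left_mono msq_drift_le')
    qed
    finally show "(\<integral>\<omega>. ?Y \<omega> * U (Suc k) \<omega> \<partial>M) \<le> (\<integral>\<omega>. ?Y \<omega> * U k \<omega> \<partial>M) + err (n + k)" by simp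
  qed (simp add: U_def msq_nonneg)
  then show ?thesis by (simp add: U_def center_def)
qed

end

section \<open>Divergent series and products of loss factors\<close>

lemma filterlim_sum_at_top_iff:
  fixes f :: "nat \<Rightarrow> real"
  assumes "\<And>k. f k \<ge> 0"
  shows "filterlim (\<lambda>n. \<Sum>k<n. f k) at_top sequentially \<longleftrightarrow> \<not> summable f"
proof
  assume lim: "filterlim (\<lambda>n. \<Sum>k<n. f k) at_top sequentially"
  show "\<not> summable f"
  proof
    assume "summable f"
    then have le: "(\<Sum>k<n. f k) \<le> suminf f" for n using assms by (intro sum_le_suminf) auto
    obtain n where "(\<Sum>k<n. f k) \<ge> suminf f + 1"
      using lim unfolding filterlim_at_top eventually_sequentially by blast
    with le[of n] show False by simp
  qed
next
  assume ns: "\<not> summable f"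
  show "filterlim (\<lambda>n. \<Sum>k<n. f k) at_top sequentially"
    unfolding filterlim_at_top
  proof
    fix c
    obtain n where "(\<Sum>k<n. f k) > c"
      using ns summableI_nonneg_bounded[of f c] assms by (meson not_le)
    moreover have "(\<Sum>k<n. f k) \<le> (\<Sum>k<m. f k)" if "n \<le> m" for m
      using assms that by (intro sum_mono2) auto
    ultimately show "eventually (\<lambda>m. c \<le> (\<Sum>k<m. f k)) sequentially"
      unfolding eventually_sequentially by (meson less_imp_le order_trans)
  qed
qed

text \<open>Once the tail of \<open>s\<close> is at most \<open>1/2\<close>, the product of the
  factors \<open>1 - s n\<close> stays above one minus their sum, so at least half of
  \<open>G m\<close> survives.\<close>

lemma weighted_decay_lower_bound:
  fixes G s :: "nat \<Rightarrow> real"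
  assumes pos: "\<And>n. n \<ge> n0 \<Longrightarrow> G n > 0" and s: "\<And>n. s n \<ge> 0" "summable s"
    and step: "\<And>n. n \<ge> n0 \<Longrightarrow> (1 - s n) * G n \<le> G (Suc n)"
  shows "\<not> G \<longlonglongrightarrow> 0"
proof
  assume lim: "G \<longlonglongrightarrow> 0"
  obtain N where N: "\<And>n. n \<ge> N \<Longrightarrow> norm (\<Sum>i. s (i + n)) < 1 / 2"
    using suminf_exist_split[OF _ s(2), of "1 / 2"] by auto
  define m where "m = max n0 N"
  have ss: "summable (\<lambda>i. s (i + m))" using s(2) by (simp add: summable_iff_shift)
  have part: "(\<Sum>j<k. s (j + m)) \<le> 1 / 2" for k
    using sum_le_suminf[OF ss, of "{..<k}"] s(1) N[of m] by (auto simp: m_def)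
  have "(1 - (\<Sum>j<k. s (j + m))) * G m \<le> G (k + m)" for k
  proof (induction k)
    case (Suc k)
    let ?S = "\<Sum>j<k. s (j + m)"
    have S: "?S \<ge> 0" "?S \<le> 1 / 2" using s(1) part by (auto intro: sum_nonneg)
    have "s (k + m) \<le> (\<Sum>j<Suc k. s (j + m))" using S by simp
    then have sk: "s (k + m) \<le> 1 / 2" using part[of "Suc k"] by linarith
    have "1 - (\<Sum>j<Suc k. s (j + m)) \<le> (1 - s (k + m)) * (1 - ?S)"
      using S(1) s(1)[of "k + m"] by (simp add: algebra_simps)
    then have "(1 - (\<Sum>j<Suc k. s (j + m))) * G m \<le> (1 - s (k + m)) * (1 - ?S) * G m"
      using pos[of m] by (intro mult_right_mono) (auto simp: m_def less_imp_le)
    also have "\<dots> \<le> (1 - s (k + m)) * G (k + m)"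
      using Suc sk by (subst mult.assoc, intro mult_left_mono) auto
    also have "\<dots> \<le> G (Suc k + m)" using step[of "k + m"] by (simp add: m_def)
    finally show ?case .
  qed simp
  moreover have "1 / 2 * G m \<le> (1 - (\<Sum>j<k. s (j + m))) * G m" for k
    using part[of k] pos[of m] by (intro mult_right_mono) (auto simp: m_def less_imp_le)
  ultimately have "1 / 2 * G m \<le> G (k + m)" for k by (meson order_trans)
  then have "1 / 2 * G m \<le> 0"
    using LIMSEQ_ignore_initial_segment[OF lim, of m] by (intro LIMSEQ_le_const[of "\<lambda>k. G (k + m)"]) auto
  then show False using pos[of m] by (simp add: m_def)
qed

section \<open>Almost sure convergence\<close>

context reinforced_process begin

text \<open>All coordinates of all late states lie near one number
  \<open>\<pi> \<bullet> Z n \<omega>\<close>, so they are Cauchy with a common limit. The clamp to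
  \<open>[0, 1]\<close> does not change this limit, and it keeps the limit variable in range on
  paths without convergence.\<close>

lemma synchronizes_pointwise:
  assumes w: "\<omega> \<in> space M"
    and dev: "\<And>c. c > 0 \<Longrightarrow> \<exists>n. \<forall>k. msq (Z (n + k) \<omega> - (\<pi> \<bullet> Z n \<omega>) *\<^sub>R 1) < c"
  shows "(\<lambda>n. Z n \<omega>) \<longlonglongrightarrow> max 0 (min 1 (lim (\<lambda>n. Z n \<omega> $ i0))) *\<^sub>R 1"
proof -
  obtain \<kappa> where \<kappa>: "\<kappa> > 0" "\<And>l. \<kappa> \<le> \<pi> $ l" using pi_lower_bound by blast
  have close: "\<exists>n. \<forall>k\<ge>n. \<forall>i. \<bar>Z k \<omega> $ i - \<pi> \<bullet> Z n \<omega>\<bar> < \<epsilon>" if eps: "\<epsilon> > 0" for \<epsilon>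
  proof -
    \<comment> \<open>The threshold is \<open>\<kappa> * \<epsilon>\<^sup>2\<close> because one
      coordinate of size \<open>\<epsilon>\<close> already contributes that much to
      \<open>msq\<close>.\<close>
    obtain n where n: "\<And>k. msq (Z (n + k) \<omega> - (\<pi> \<bullet> Z n \<omega>) *\<^sub>R 1) < \<kappa> * \<epsilon>\<^sup>2"
      using dev[of "\<kappa> * \<epsilon>\<^sup>2"] eps \<kappa>(1) by auto
    have "\<bar>Z k \<omega> $ i - \<pi> \<bullet> Z n \<omega>\<bar> < \<epsilon>" if "k \<ge> n" for k i
    proof -
      let ?d = "Z k \<omega> $ i - \<pi> \<bullet> Z n \<omega>"
      have "\<kappa> * ?d\<^sup>2 \<le> \<pi> $ i * ?d\<^sup>2" using \<kappa> by (intro mult_right_mono) auto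
      also have "\<dots> \<le> msq (Z k \<omega> - (\<pi> \<bullet> Z n \<omega>) *\<^sub>R 1)"
        using msq_ge_component[of i "Z k \<omega> - (\<pi> \<bullet> Z n \<omega>) *\<^sub>R 1"] by simp
      also have "\<dots> < \<kappa> * \<epsilon>\<^sup>2" using n[of "k - n"] that by simp
      finally have "\<bar>?d\<bar>\<^sup>2 < \<epsilon>\<^sup>2" using \<kappa>(1) by simp
      then show ?thesis using eps by (intro power2_less_imp_less[of _ \<epsilon>]) auto
    qed
    then show ?thesis by blast
  qed
  have "Cauchy (\<lambda>n. Z n \<omega> $ i0)"
  proof (rule metric_CauchyI)
    fix \<epsilon> :: real assume "\<epsilon> > 0"
    then obtain n where n: "\<And>k i. k \<ge> n \<Longrightarrow> \<bar>Z k \<omega> $ i - \<pi> \<bullet> Z n \<omega>\<bar> < \<epsilon> / 2"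
      using close[of "\<epsilon> / 2"] by auto
    have "dist (Z k \<omega> $ i0) (Z m \<omega> $ i0) < \<epsilon>" if "k \<ge> n" "m \<ge> n" for k m
      using n[OF that(1), of i0] n[OF that(2), of i0] unfolding dist_real_def by linarith
    then show "\<exists>N. \<forall>m\<ge>N. \<forall>k\<ge>N. dist (Z m \<omega> $ i0) (Z k \<omega> $ i0) < \<epsilon>" by blast
  qed
  then have "convergent (\<lambda>n. Z n \<omega> $ i0)" by (rule Cauchy_convergent)
  then have L: "(\<lambda>n. Z n \<omega> $ i0) \<longlonglongrightarrow> lim (\<lambda>n. Z n \<omega> $ i0)" (is "_ \<longlonglongrightarrow> ?L")
    by (simp add: convergent_LIMSEQ_iff)
  have "0 \<le> ?L" "?L \<le> 1"
    using Z_range[OF w] by (auto intro!: LIMSEQ_le_const[OF L] LIMSEQ_le_const2[OF L])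
  moreover have "(\<lambda>n. Z n \<omega> $ i) \<longlonglongrightarrow> ?L" for i
  proof -
    have "(\<lambda>n. Z n \<omega> $ i - Z n \<omega> $ i0) \<longlonglongrightarrow> 0"
    proof (rule LIMSEQ_I)
      fix \<epsilon> :: real assume "\<epsilon> > 0"
      then obtain n where n: "\<And>k i. k \<ge> n \<Longrightarrow> \<bar>Z k \<omega> $ i - \<pi> \<bullet> Z n \<omega>\<bar> < \<epsilon> / 2"
        using close[of "\<epsilon> / 2"] by auto
      have "norm (Z k \<omega> $ i - Z k \<omega> $ i0 - 0) < \<epsilon>" if "k \<ge> n" for k
        using n[OF that, of i] n[OF that, of i0] unfolding real_norm_def by linarith
      then show "\<exists>N. \<forall>k\<ge>N. norm (Z k \<omega> $ i - Z k \<omega> $ i0 - 0) < \<epsilon>" by blast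
    qed
    from tendsto_add[OF this L] show ?thesis by simp
  qed
  ultimately show ?thesis by (intro vec_tendstoI) (simp add: max_def min_def)
qed

text \<open>For \<open>c > 0\<close> the event that a deviation of at least \<open>c\<close> occurs
  after every \<open>n\<close> has probability at most \<open>S n / c\<close> for all
  \<open>n\<close>, hence 0. Countably many levels \<open>1 / Suc i\<close> suffice.\<close>

lemma synchronizes_if_flow_contracts:
  assumes flow: "\<And>n x. \<pi> \<bullet> x = 0 \<Longrightarrow> (\<lambda>m. msq (flow r n m x)) \<longlonglongrightarrow> 0"
  shows "ae_synchronizes M Z"
proof -
  define S where "S n = (\<integral>\<omega>. msq (center (Z n \<omega>)) \<partial>M) + (\<Sum>k. err (n + k))" for n
  have "(\<lambda>n. suminf err - (\<Sum>k<n. err k)) \<longlonglongrightarrow> suminf err - suminf err"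
    by (intro tendsto_diff tendsto_const summable_LIMSEQ summable_err)
  then have "(\<lambda>n. \<Sum>k. err (n + k)) \<longlonglongrightarrow> 0"
    using suminf_minus_initial_segment[OF summable_err] by (simp add: add.commute)
  then have S: "S \<longlonglongrightarrow> 0"
    unfolding S_def using tendsto_add[OF energy_tendsto_0[OF flow]] by fastforce
  have Zm[measurable]: "(\<lambda>\<omega>. Z n \<omega> $ l) \<in> borel_measurable M" for n l
    using bm_M[OF bm_Z[of n n]] by (simp add: bounded_measurable_def)
  define U where "U n k \<omega> = msq (Z (n + k) \<omega> - (\<pi> \<bullet> Z n \<omega>) *\<^sub>R 1)" for n k \<omega>
  have [measurable]: "U n k \<in> borel_measurable M" for n k
    unfolding U_def msq_def inner_vec_def inner_real_def vector_minus_component vector_scaleR_component by measurable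
  define B where "B c = {\<omega>\<in>space M. \<forall>n. \<exists>k. U n k \<omega> \<ge> c}" for c
  have Bm[measurable]: "B c \<in> sets M" for c unfolding B_def by measurable
  have "prob (B c) = 0" if c: "c > 0" for c
  proof -
    have "c * prob (B c) \<le> S n" for n
    proof -
      have "prob (B c) \<le> prob {\<omega>\<in>space M. \<exists>k. U n k \<omega> \<ge> c}"
        by (intro finite_measure_mono) (auto simp: B_def)
      then have "c * prob (B c) \<le> c * prob {\<omega>\<in>space M. \<exists>k. U n k \<omega> \<ge> c}" using c by simp
      also have "\<dots> \<le> S n" unfolding S_def U_def by (rule deviation_probability[OF c])
      finally show ?thesis .
    qed
    then have "c * prob (B c) \<le> 0" by (intro LIMSEQ_le_const[OF S]) auto
    then have "prob (B c) \<le> 0" using c by (simp add: mult_le_0_iff)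
    then show ?thesis using measure_nonneg[of M "B c"] by linarith
  qed
  then have "B (1 / real (Suc i)) \<in> null_sets M" for i
    by (intro null_setsI) (auto simp: emeasure_eq_measure)
  then have "AE \<omega> in M. \<forall>i. \<omega> \<notin> B (1 / real (Suc i))"
    unfolding AE_all_countable by (intro allI AE_not_in)
  then have lim: "AE \<omega> in M. (\<lambda>n. Z n \<omega>) \<longlonglongrightarrow> max 0 (min 1 (lim (\<lambda>n. Z n \<omega> $ undefined))) *\<^sub>R 1"
  proof (rule AE_mp, intro AE_I2 impI)
    fix \<omega> assume w: "\<omega> \<in> space M" and nB: "\<forall>i. \<omega> \<notin> B (1 / real (Suc i))"
    show "(\<lambda>n. Z n \<omega>) \<longlonglongrightarrow> max 0 (min 1 (lim (\<lambda>n. Z n \<omega> $ undefined))) *\<^sub>R 1"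
    proof (rule synchronizes_pointwise[OF w])
      fix c :: real assume "c > 0"
      then obtain i where i: "1 / real (Suc i) < c" using nat_approx_posE by metis
      have "\<exists>n. \<forall>k. U n k \<omega> < 1 / real (Suc i)" using nB w by (auto simp: B_def not_le)
      then show "\<exists>n. \<forall>k. msq (Z (n + k) \<omega> - (\<pi> \<bullet> Z n \<omega>) *\<^sub>R 1) < c"
        unfolding U_def using i by (meson less_trans)
    qed
  qed
  show ?thesis unfolding ae_synchronizes_def
  proof (intro exI conjI)
    show "(\<lambda>\<omega>. max 0 (min 1 (lim (\<lambda>n. Z n \<omega> $ undefined)))) \<in> borel_measurable M"
      by (intro borel_measurable_max borel_measurable_min borel_measurable_const borel_measurable_lim_metric Zm)
  qed (use lim in auto)
qed

lemma synchronizes_if_divergent: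
  assumes "\<not> summable (\<lambda>n. r n * (1 - r n))"
  shows "ae_synchronizes M Z"
  by (intro synchronizes_if_flow_contracts flow_tendsto_0_divergent r_bounds' assms)

lemma synchronizes_if_aperiodic:
  assumes "mat_period P = 1" "\<not> summable r"
  shows "ae_synchronizes M Z"
proof (cases "summable (\<lambda>n. r n * (1 - r n))")
  case True
  \<comment> \<open>If eventually \<open>r n \<le> 1 - e\<close>, then \<open>r n\<close> is at most
    \<open>1 / e\<close> times the summable \<open>r n * (1 - r n)\<close>, against the divergence
    of the sum of \<open>r\<close>.\<close>
  have "\<exists>\<^sub>F n in sequentially. r n > 1 - e" if e: "e > 0" for e
  proof (rule ccontr)
    assume "\<not> ?thesis"
    then have "eventually (\<lambda>n. norm (r n) \<le> 1 / e * (r n * (1 - r n))) sequentially"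
      unfolding not_frequently
    proof eventually_elim
      fix n assume "\<not> r n > 1 - e"
      then have "r n * e \<le> r n * (1 - r n)" using r_bounds[of n] by (intro mult_left_mono) auto
      then show "norm (r n) \<le> 1 / e * (r n * (1 - r n))" using e r_bounds[of n] by (simp add: field_simps)
    qed
    then have "summable r"
      by (rule summable_comparison_test_ev) (intro summable_mult True)
    with assms(2) show False ..
  qed
  then show ?thesis
    by (intro synchronizes_if_flow_contracts flow_tendsto_0_aperiodic r_bounds' assms)
qed (rule synchronizes_if_divergent)

section \<open>Failure of synchronization\<close>

text \<open>The mean heterozygosity of a coordinate; with values in \<open>[0, 1]\<close> it
  vanishes exactly if the coordinate is almost surely \<open>0\<close> or \<open>1\<close>.\<close>

definition het :: "nat \<Rightarrow> 'n \<Rightarrow> real" where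
  "het n l = (\<integral>\<omega>. Z n \<omega> $ l * (1 - Z n \<omega> $ l) \<partial>M)"

lemma bm_Z_M: "bounded_measurable M M (\<lambda>\<omega>. Z n \<omega> $ l)"
  by (rule bm_M[OF bm_Z[OF order_refl]])

lemma het_Suc:
  "het (Suc n) l = (\<integral>\<omega>. (1 - r n) * (Z n \<omega> $ l * (1 - Z n \<omega> $ l))
     + r n * (1 - r n) * (p n l \<omega> * (1 - p n l \<omega>) + (Z n \<omega> $ l - p n l \<omega>)\<^sup>2) \<partial>M)"
proof -
  note bm = bm_integrable bm_intros bm_Z_M bm_M[OF bm_p] bm_M[OF bm_drift_Z]
  have lin: "linear (\<lambda>x :: real ^ 'n. x $ l)" by (rule linearI) auto
  have ax: "(\<Sum>k\<in>UNIV. (axis k 1 $ l :: real)\<^sup>2 * noise n (\<lambda>_. 1) k) = noise n (\<lambda>_. 1) l"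
    by (simp add: axis_def if_distrib[where f = "\<lambda>x. x\<^sup>2 * _"] cong: if_cong)
  \<comment> \<open>Completing the square, \<open>z * (1 - z) = 1/4 - (z - 1/2)\<^sup>2\<close>,
    brings in the moment identity with center \<open>1/2\<close>.\<close>
  have "het (Suc n) l = (\<integral>\<omega>. 1 / 4 - (Z (Suc n) \<omega> $ l - 1 / 2)\<^sup>2 \<partial>M)"
    unfolding het_def by (simp add: power2_eq_square algebra_simps)
  also have "\<dots> = (\<integral>\<omega>. 1 / 4 \<partial>M) - (\<integral>\<omega>. (Z (Suc n) \<omega> $ l - 1 / 2)\<^sup>2 \<partial>M)"
    by (intro Bochner_Integration.integral_diff bm)
  also have "(\<integral>\<omega>. (Z (Suc n) \<omega> $ l - 1 / 2)\<^sup>2 \<partial>M) =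
      (\<integral>\<omega>. (drift (r n) (Z n \<omega>) $ l - 1 / 2)\<^sup>2 \<partial>M) + (r n)\<^sup>2 * (\<integral>\<omega>. p n l \<omega> * (1 - p n l \<omega>) \<partial>M)"
    using second_moment_step[where n = n and Y = "\<lambda>_. 1" and c = "\<lambda>_. 1 / 2", OF bounded_measurable_const bounded_measurable_const lin]
    unfolding ax by (simp add: noise_def)
  also have "(\<integral>\<omega>. 1 / 4 \<partial>M) - \<dots> = (\<integral>\<omega>. 1 / 4 - ((drift (r n) (Z n \<omega>) $ l - 1 / 2)\<^sup>2 + (r n)\<^sup>2 * (p n l \<omega> * (1 - p n l \<omega>))) \<partial>M)"
    by (subst Bochner_Integration.integral_diff, intro bm, intro bm, subst Bochner_Integration.integral_add,
        intro bm, intro bm, simp)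
  also have "\<dots> = (\<integral>\<omega>. (1 - r n) * (Z n \<omega> $ l * (1 - Z n \<omega> $ l))
     + r n * (1 - r n) * (p n l \<omega> * (1 - p n l \<omega>) + (Z n \<omega> $ l - p n l \<omega>)\<^sup>2) \<partial>M)"
    by (intro Bochner_Integration.integral_cong refl) (simp add: drift_def p_def power2_eq_square field_simps)
  finally show ?thesis .
qed

lemma het_nonneg: "het n l \<ge> 0"
  unfolding het_def using Z_range by (intro Bochner_Integration.integral_nonneg) auto

lemma het_Suc_ge: "het (Suc n) l \<ge> (1 - r n) * het n l"
proof -
  note bm = bm_integrable bm_intros bm_Z_M bm_M[OF bm_p]
  have "(1 - r n) * het n l = (\<integral>\<omega>. (1 - r n) * (Z n \<omega> $ l * (1 - Z n \<omega> $ l)) \<partial>M)"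
    by (simp add: het_def)
  also have "\<dots> \<le> het (Suc n) l" unfolding het_Suc
  proof (rule integral_mono)
    fix \<omega> assume w: "\<omega> \<in> space M"
    have "0 \<le> r n * (1 - r n) * (p n l \<omega> * (1 - p n l \<omega>) + (Z n \<omega> $ l - p n l \<omega>)\<^sup>2)"
      using r_bounds'[of n] p_range[OF w, of n l] by simp
    then show "(1 - r n) * (Z n \<omega> $ l * (1 - Z n \<omega> $ l)) \<le> (1 - r n) * (Z n \<omega> $ l * (1 - Z n \<omega> $ l))
     + r n * (1 - r n) * (p n l \<omega> * (1 - p n l \<omega>) + (Z n \<omega> $ l - p n l \<omega>)\<^sup>2)" by simp
  qed (intro bm)+
  finally show ?thesis .
qed

text \<open>All terms in \<open>het_Suc\<close> are non-negative with positive coefficients. Their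
  vanishing makes the initial coordinates \<open>0\<close> or \<open>1\<close> and the initial
  vector harmonic, hence constant.\<close>

lemma het_1_eq_0_imp:
  assumes "\<And>l. het (Suc 0) l = 0"
  shows "AE \<omega> in M. Z 0 \<omega> = 0 \<or> Z 0 \<omega> = 1"
proof -
  define g where "g l \<omega> = (1 - r 0) * (Z 0 \<omega> $ l * (1 - Z 0 \<omega> $ l))
     + r 0 * (1 - r 0) * (p 0 l \<omega> * (1 - p 0 l \<omega>) + (Z 0 \<omega> $ l - p 0 l \<omega>)\<^sup>2)" for l \<omega>
  have "AE \<omega> in M. g l \<omega> = 0" for l
  proof (subst integral_nonneg_eq_0_iff_AE[symmetric])
    show "integrable M (g l)" unfolding g_def by (intro bm_integrable bm_intros bm_Z_M bm_M[OF bm_p])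
    show "(\<integral>\<omega>. g l \<omega> \<partial>M) = 0" using assms[of l] unfolding het_Suc g_def .
    show "AE \<omega> in M. 0 \<le> g l \<omega>"
      unfolding g_def using r_bounds'[of 0] Z_range p_range by (intro AE_I2) auto
  qed
  then have "AE \<omega> in M. \<forall>l. g l \<omega> = 0" by (simp add: AE_all_countable)
  then show ?thesis
  proof (rule AE_mp, intro AE_I2 impI)
    fix \<omega> assume w: "\<omega> \<in> space M" and g0: "\<forall>l. g l \<omega> = 0"
    have both: "Z 0 \<omega> $ l * (1 - Z 0 \<omega> $ l) = 0 \<and> Z 0 \<omega> $ l = p 0 l \<omega>" for l
    proof -
      define a where "a = Z 0 \<omega> $ l * (1 - Z 0 \<omega> $ l)"
      define b where "b = p 0 l \<omega> * (1 - p 0 l \<omega>)"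
      define d where "d = (Z 0 \<omega> $ l - p 0 l \<omega>)\<^sup>2"
      have nn: "a \<ge> 0" "b \<ge> 0" "d \<ge> 0"
        using Z_range[OF w, of 0 l] p_range[OF w, of 0 l] by (auto simp: a_def b_def d_def)
      have rr: "1 - r 0 > 0" "r 0 * (1 - r 0) > 0" using r_bounds[of 0] by auto
      have "(1 - r 0) * a + r 0 * (1 - r 0) * (b + d) = 0"
        using g0 by (simp add: g_def a_def b_def d_def)
      moreover have "(1 - r 0) * a \<ge> 0" "r 0 * (1 - r 0) * (b + d) \<ge> 0" using nn rr by simp_all
      ultimately have "(1 - r 0) * a = 0" "r 0 * (1 - r 0) * (b + d) = 0" by linarith+
      then have "a = 0" "b + d = 0" using rr by auto
      moreover from this have "d = 0" using nn by linarith
      ultimately show ?thesis by (simp add: a_def d_def)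
    qed
    then have "P *v Z 0 \<omega> = Z 0 \<omega>" by (simp add: vec_eq_iff p_def)
    then have cst: "Z 0 \<omega> $ i = Z 0 \<omega> $ j" for i j by (rule harmonic_imp_constant)
    have "Z 0 \<omega> $ undefined * (1 - Z 0 \<omega> $ undefined) = 0" using both by blast
    then have "Z 0 \<omega> $ undefined = 0 \<or> Z 0 \<omega> $ undefined = 1" by simp
    then show "Z 0 \<omega> = 0 \<or> Z 0 \<omega> = 1"
      unfolding vec_eq_iff one_index zero_index using cst by metis
  qed
qed

lemma Z0_eq_sets: "{\<omega>\<in>space M. Z 0 \<omega> = c} \<in> sets M"
  using measurable_sets[OF Z0_meas, of "{c}"] by (simp add: vimage_def Int_def conj_commute)

text \<open>Positivity starts at time 1: an initial vector mixing zeros and ones has no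
  heterozygosity yet. Afterwards each step keeps at least the fraction
  \<open>1 - r n\<close>.\<close>

lemma het_pos:
  assumes "prob {\<omega>\<in>space M. Z 0 \<omega> = 0} + prob {\<omega>\<in>space M. Z 0 \<omega> = 1} < 1"
  shows "\<exists>l. \<forall>n. het (Suc n) l > 0"
proof -
  have "\<exists>l. het (Suc 0) l > 0"
  proof (rule ccontr)
    assume "\<not> ?thesis"
    then have "het (Suc 0) l = 0" for l using het_nonneg[of "Suc 0" l] by (metis order_antisym not_less)
    then have ae: "AE \<omega> in M. Z 0 \<omega> = 0 \<or> Z 0 \<omega> = 1" by (rule het_1_eq_0_imp)
    have "1 = prob ({\<omega>\<in>space M. Z 0 \<omega> = 0} \<union> {\<omega>\<in>space M. Z 0 \<omega> = 1})"
      using ae by (intro prob_eq_1[THEN iffD2, symmetric] sets.Un Z0_eq_sets) auto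
    also have "\<dots> \<le> prob {\<omega>\<in>space M. Z 0 \<omega> = 0} + prob {\<omega>\<in>space M. Z 0 \<omega> = 1}"
      by (intro measure_Un_le Z0_eq_sets)
    finally show False using assms by simp
  qed
  then obtain l where l: "het (Suc 0) l > 0" by blast
  have "het (Suc n) l > 0" for n
  proof (induction n)
    case (Suc n)
    have "0 < (1 - r (Suc n)) * het (Suc n) l" using Suc r_bounds[of "Suc n"] by simp
    also have "\<dots> \<le> het (Suc (Suc n)) l" by (rule het_Suc_ge)
    finally show ?case .
  qed (rule l)
  then show ?thesis by blast
qed

text \<open>By stationarity and \<open>\<pi> $ l > 0\<close>, column \<open>l\<close> of
  \<open>P\<close> has a positive entry, in some row \<open>i\<close>. Then \<open>p n i\<close> and
  \<open>1 - p n i\<close> are at least that entry times \<open>Z n \<omega> $ l\<close> and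
  \<open>1 - Z n \<omega> $ l\<close>.\<close>

lemma noise_pos:
  assumes "het n l > 0"
  shows "\<exists>i. noise n (\<lambda>_. 1) i > 0"
proof -
  note bm = bm_integrable bm_intros bm_Z_M bm_M[OF bm_p]
  have "\<exists>i. P $ i $ l > 0"
  proof (rule ccontr)
    assume "\<not> ?thesis"
    then have "P $ i $ l = 0" for i using P_nonneg[of i l] by (metis order_antisym not_less)
    then have "(\<pi> v* P) $ l = 0" by (simp add: vector_matrix_mult_def)
    then show False using pi_pos[of l] by (simp add: pi_stat)
  qed
  then obtain i where i: "P $ i $ l > 0" by blast
  have "0 < (P $ i $ l)\<^sup>2 * het n l" using i assms by simp
  also have "\<dots> = (\<integral>\<omega>. (P $ i $ l)\<^sup>2 * (Z n \<omega> $ l * (1 - Z n \<omega> $ l)) \<partial>M)" by (simp add: het_def)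
  also have "\<dots> \<le> noise n (\<lambda>_. 1) i" unfolding noise_def
  proof (rule integral_mono)
    fix \<omega> assume w: "\<omega> \<in> space M"
    have "P $ i $ l * Z n \<omega> $ l \<le> p n i \<omega>"
      unfolding p_def Pv_nth using P_nonneg Z_range[OF w]
      by (intro member_le_sum[of l UNIV "\<lambda>j. P $ i $ j * Z n \<omega> $ j"]) auto
    moreover have "P $ i $ l * (1 - Z n \<omega> $ l) \<le> (\<Sum>j\<in>UNIV. P $ i $ j * (1 - Z n \<omega> $ j))"
      using P_nonneg Z_range[OF w]
      by (intro member_le_sum[of l UNIV "\<lambda>j. P $ i $ j * (1 - Z n \<omega> $ j)"]) auto
    then have "P $ i $ l * (1 - Z n \<omega> $ l) \<le> 1 - p n i \<omega>"
      by (simp add: p_def Pv_nth right_diff_distrib sum_subtractf row_sum_1[OF P_one])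
    ultimately have "P $ i $ l * Z n \<omega> $ l * (P $ i $ l * (1 - Z n \<omega> $ l)) \<le> p n i \<omega> * (1 - p n i \<omega>)"
      using i Z_range[OF w, of n l] p_range[OF w, of n i] by (intro mult_mono) auto
    then show "(P $ i $ l)\<^sup>2 * (Z n \<omega> $ l * (1 - Z n \<omega> $ l)) \<le> 1 * (p n i \<omega> * (1 - p n i \<omega>))"
      by (simp add: power2_eq_square ac_simps)
  qed (intro bm)+
  finally show ?thesis by blast
qed

text \<open>The mean of the quadratic form becomes positive through noise and shrinks only by
  summable relative losses, so it stays away from 0. Synchronization would send it to 0, since the
  form vanishes on constants.\<close>

lemma not_synchronizes:
  fixes f :: "'b \<Rightarrow> real ^ 'n \<Rightarrow> real"
  assumes nontriv: "prob {\<omega>\<in>space M. Z 0 \<omega> = 0} + prob {\<omega>\<in>space M. Z 0 \<omega> = 1} < 1"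
    and sum: "summable (\<lambda>n. r n * (1 - r n))"
    and fin: "finite I" and lin: "\<And>a. linear (f a)" and f1: "\<And>a. a \<in> I \<Longrightarrow> f a 1 = 0"
    and pos: "\<And>l. (\<Sum>a\<in>I. (f a (axis l 1))\<^sup>2) > 0"
    and drift: "\<And>n x. n \<ge> n0 \<Longrightarrow> (1 - 4 * (r n * (1 - r n))) * (\<Sum>a\<in>I. (f a x)\<^sup>2) \<le> (\<Sum>a\<in>I. (f a (drift (r n) x))\<^sup>2)"
  shows "\<not> ae_synchronizes M Z"
proof
  assume "ae_synchronizes M Z"
  then obtain L where L: "AE \<omega> in M. (\<lambda>n. Z n \<omega>) \<longlonglongrightarrow> L \<omega> *\<^sub>R 1" by (auto simp: ae_synchronizes_def)
  define g where "g x = (\<Sum>a\<in>I. (f a x)\<^sup>2)" for x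
  define G where "G n = (\<integral>\<omega>. g (Z n \<omega>) \<partial>M)" for n
  have bmg: "bounded_measurable M M (\<lambda>\<omega>. g (h \<omega>))" if "\<And>l. bounded_measurable M M (\<lambda>\<omega>. h \<omega> $ l)" for h
    unfolding g_def by (intro bm_intros bm_linear[OF lin] that)
  have gsum: "(\<integral>\<omega>. g (h \<omega>) \<partial>M) = (\<Sum>a\<in>I. \<integral>\<omega>. (f a (h \<omega>))\<^sup>2 \<partial>M)" if "\<And>l. bounded_measurable M M (\<lambda>\<omega>. h \<omega> $ l)" for h
    unfolding g_def by (intro Bochner_Integration.integral_sum bm_integrable bm_intros bm_linear[OF lin] that)
  have step: "G (Suc n) = (\<integral>\<omega>. g (drift (r n) (Z n \<omega>)) \<partial>M) + (r n)\<^sup>2 * (\<Sum>l\<in>UNIV. g (axis l 1) * noise n (\<lambda>_. 1) l)" for n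
  proof -
    have "G (Suc n) = (\<Sum>a\<in>I. (\<integral>\<omega>. (f a (drift (r n) (Z n \<omega>)))\<^sup>2 \<partial>M) + (r n)\<^sup>2 * (\<Sum>l\<in>UNIV. (f a (axis l 1))\<^sup>2 * noise n (\<lambda>_. 1) l))"
      unfolding G_def gsum[OF bm_Z_M]
      using second_moment_step[where n = n and Y = "\<lambda>_. 1" and c = "\<lambda>_. 0", OF bounded_measurable_const bounded_measurable_const lin]
      by simp
    also have "\<dots> = (\<integral>\<omega>. g (drift (r n) (Z n \<omega>)) \<partial>M) + (r n)\<^sup>2 * (\<Sum>a\<in>I. \<Sum>l\<in>UNIV. (f a (axis l 1))\<^sup>2 * noise n (\<lambda>_. 1) l)"
      unfolding gsum[OF bm_M[OF bm_drift_Z]] by (simp add: sum.distrib sum_distrib_left)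
    also have "(\<Sum>a\<in>I. \<Sum>l\<in>UNIV. (f a (axis l 1))\<^sup>2 * noise n (\<lambda>_. 1) l) = (\<Sum>l\<in>UNIV. g (axis l 1) * noise n (\<lambda>_. 1) l)"
      unfolding g_def sum_distrib_right by (rule sum.swap)
    finally show ?thesis .
  qed
  have noise_nn: "noise n (\<lambda>_. 1) l \<ge> 0" for n l by (rule noise_nonneg) simp
  have g_axis: "g (axis l 1) > 0" for l using pos by (simp add: g_def)
  have G_nn: "G n \<ge> 0" for n
    unfolding G_def g_def by (intro Bochner_Integration.integral_nonneg sum_nonneg) auto
  have Gd: "(1 - 4 * (r n * (1 - r n))) * G n \<le> (\<integral>\<omega>. g (drift (r n) (Z n \<omega>)) \<partial>M)" if "n \<ge> n0" for n
  proof -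
    have "(1 - 4 * (r n * (1 - r n))) * G n = (\<integral>\<omega>. (1 - 4 * (r n * (1 - r n))) * g (Z n \<omega>) \<partial>M)"
      by (simp add: G_def)
    also have "\<dots> \<le> (\<integral>\<omega>. g (drift (r n) (Z n \<omega>)) \<partial>M)"
      using drift[OF that] unfolding g_def[symmetric]
      by (intro integral_mono bm_integrable bm_intros bmg bm_Z_M bm_M[OF bm_drift_Z])
    finally show ?thesis .
  qed
  have extra_nn: "0 \<le> (r n)\<^sup>2 * (\<Sum>l\<in>UNIV. g (axis l 1) * noise n (\<lambda>_. 1) l)" for n
    using g_axis noise_nn by (intro mult_nonneg_nonneg sum_nonneg) (auto simp: less_imp_le)
  \<comment> \<open>Heterozygosity is positive from time 1 on, and the noise it causes enters the
    form one step later; hence the offset 2.\<close>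
  have "G n > 0" if "n \<ge> n0 + 2" for n
  proof -
    define m where "m = n - 2"
    have m: "n = Suc (Suc m)" using that by (simp add: m_def)
    obtain l where "het (Suc m) l > 0" using het_pos[OF nontriv] by blast
    then obtain i where i: "noise (Suc m) (\<lambda>_. 1) i > 0" using noise_pos by blast
    have "0 < (\<Sum>l\<in>UNIV. g (axis l 1) * noise (Suc m) (\<lambda>_. 1) l)"
      using g_axis noise_nn i by (intro sum_pos2[of _ i]) (auto simp: less_imp_le)
    then have "0 < (r (Suc m))\<^sup>2 * (\<Sum>l\<in>UNIV. g (axis l 1) * noise (Suc m) (\<lambda>_. 1) l)"
      using r_bounds[of "Suc m"] by simp
    moreover have "0 \<le> (\<integral>\<omega>. g (drift (r (Suc m)) (Z (Suc m) \<omega>)) \<partial>M)"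
      unfolding g_def by (intro Bochner_Integration.integral_nonneg sum_nonneg) auto
    ultimately show ?thesis unfolding m step by linarith
  qed
  moreover have "(1 - 4 * (r n * (1 - r n))) * G n \<le> G (Suc n)" if "n \<ge> n0 + 2" for n
    using Gd[of n] extra_nn[of n] that unfolding step[of n] by linarith
  ultimately have "\<not> G \<longlonglongrightarrow> 0"
    using sum r_bounds' by (intro weighted_decay_lower_bound[of "n0 + 2" G "\<lambda>n. 4 * (r n * (1 - r n))"] summable_mult) auto
  moreover have "G \<longlonglongrightarrow> 0"
  proof -
    \<comment> \<open>A bound for \<open>f a\<close> on the unit cube, giving the dominating
      constant.\<close>
    define K where "K a = (\<Sum>l\<in>UNIV. \<bar>f a (axis l 1)\<bar>)" for a
    have "(\<lambda>n. \<integral>\<omega>. g (Z n \<omega>) \<partial>M) \<longlonglongrightarrow> (\<integral>\<omega>. 0 \<partial>M)"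
    proof (rule integral_dominated_convergence)
      show "AE \<omega> in M. (\<lambda>n. g (Z n \<omega>)) \<longlonglongrightarrow> 0"
        using L
      proof eventually_elim
        fix \<omega> assume lim: "(\<lambda>n. Z n \<omega>) \<longlonglongrightarrow> L \<omega> *\<^sub>R 1"
        have "(\<lambda>n. f a (Z n \<omega>)) \<longlonglongrightarrow> f a (L \<omega> *\<^sub>R 1)" for a
          using bounded_linear.tendsto[OF linear_conv_bounded_linear[THEN iffD1, OF lin] lim] .
        then have "(\<lambda>n. g (Z n \<omega>)) \<longlonglongrightarrow> (\<Sum>a\<in>I. (f a (L \<omega> *\<^sub>R 1))\<^sup>2)"
          unfolding g_def by (intro tendsto_sum tendsto_power)
        then show "(\<lambda>n. g (Z n \<omega>)) \<longlonglongrightarrow> 0" using f1 by (simp add: linear_cmul[OF lin])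
      qed
      show "AE \<omega> in M. norm (g (Z n \<omega>)) \<le> (\<Sum>a\<in>I. (K a)\<^sup>2)" for n
      proof (rule AE_I2)
        fix \<omega> assume w: "\<omega> \<in> space M"
        have "\<bar>f a (Z n \<omega>)\<bar> \<le> K a" for a
        proof -
          have "\<bar>f a (Z n \<omega>)\<bar> \<le> (\<Sum>l\<in>UNIV. \<bar>Z n \<omega> $ l * f a (axis l 1)\<bar>)"
            unfolding linear_expansion[OF lin, of a "Z n \<omega>"] by (rule sum_abs)
          also have "\<dots> \<le> K a" unfolding K_def abs_mult
            using Z_range[OF w, of n] by (intro sum_mono mult_left_le_one_le) auto
          finally show ?thesis .
        qed
        then have "(f a (Z n \<omega>))\<^sup>2 \<le> (K a)\<^sup>2" for a by (metis abs_ge_zero power2_abs power_mono)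
        then have "g (Z n \<omega>) \<le> (\<Sum>a\<in>I. (K a)\<^sup>2)" unfolding g_def by (intro sum_mono)
        moreover have "g (Z n \<omega>) \<ge> 0" unfolding g_def by (intro sum_nonneg) auto
        ultimately show "norm (g (Z n \<omega>)) \<le> (\<Sum>a\<in>I. (K a)\<^sup>2)" by simp
      qed
      show "(\<lambda>\<omega>. g (Z n \<omega>)) \<in> borel_measurable M" for n
        using bmg[OF bm_Z_M] by (simp add: bounded_measurable_def)
    qed auto
    then show ?thesis unfolding G_def[abs_def] by simp
  qed
  ultimately show False ..
qed

text \<open>The form is the variance under \<open>\<pi>\<close>, which \<open>P\<close> contracts;
  this suffices once \<open>r n < 1/2\<close>, whatever the period.\<close>

lemma not_synchronizes_if_summable:
  assumes nontriv: "prob {\<omega>\<in>space M. Z 0 \<omega> = 0} + prob {\<omega>\<in>space M. Z 0 \<omega> = 1} < 1"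
    and card: "CARD('n) \<ge> 2" and sum: "summable r"
  shows "\<not> ae_synchronizes M Z"
proof -
  define f where "f i x = sqrt (\<pi> $ i) * center x $ i" for i x
  have f_msq: "(\<Sum>i\<in>UNIV. (f i x)\<^sup>2) = msq (center x)" for x
    using pi_pos by (simp add: f_def msq_def power_mult_distrib less_imp_le)
  have lin: "linear (f a)" for a
    by (rule linearI) (simp_all add: f_def linear_add[OF linear_center] linear_cmul[OF linear_center] distrib_left)
  have "eventually (\<lambda>n. r n < 1 / 2) sequentially"
    using summable_LIMSEQ_zero[OF sum] by (intro order_tendstoD(2)) auto
  then obtain n0 where n0: "\<And>n. n \<ge> n0 \<Longrightarrow> r n < 1 / 2" by (auto simp: eventually_sequentially)
  show ?thesis
  proof (rule not_synchronizes[OF nontriv _ _ lin])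
    show "summable (\<lambda>n. r n * (1 - r n))"
      by (rule summable_comparison_test'[OF sum, of 0]) (use r_bounds' in \<open>auto simp: abs_mult mult_left_le\<close>)
    show "f a 1 = 0" for a by (simp add: f_def center_def pi_inner_one)
    show "(\<Sum>a\<in>UNIV. (f a (axis l 1))\<^sup>2) > 0" for l
    proof -
      \<comment> \<open>A second index of positive mass forces \<open>\<pi> $ l < 1\<close>, so the
        variance \<open>\<pi> $ l - (\<pi> $ l)\<^sup>2\<close> of the unit vector is
        positive.\<close>
      obtain j where j: "j \<noteq> l"
        using card by (metis (full_types) UNIV_I card_2_iff' card_le_Suc0_iff_eq finite not_less_eq_eq numeral_2_eq_2)
      have "\<pi> $ j + \<pi> $ l = (\<Sum>i\<in>{j, l}. \<pi> $ i)" using j by simp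
      also have "\<dots> \<le> 1" unfolding pi_sum[symmetric] using pi_pos by (intro sum_mono2) (auto simp: less_imp_le)
      finally have "\<pi> $ l < 1" using pi_pos[of j] by linarith
      then have "(\<pi> $ l)\<^sup>2 < \<pi> $ l" using pi_pos[of l] by (simp add: power2_eq_square)
      then show ?thesis unfolding f_msq msq_center msq_axis by (simp add: inner_axis)
    qed
    show "(1 - 4 * (r n * (1 - r n))) * (\<Sum>a\<in>UNIV. (f a x)\<^sup>2) \<le> (\<Sum>a\<in>UNIV. (f a (drift (r n) x))\<^sup>2)" if "n \<ge> n0" for n x
    proof (rule sum_squares_drift_ge[OF _ _ lin])
      show "(\<Sum>a\<in>UNIV. (f a (P *v x))\<^sup>2) \<le> (\<Sum>a\<in>UNIV. (f a x)\<^sup>2)"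
        unfolding f_msq center_P by (rule msq_P_le)
    qed (use r_bounds'[of n] n0[OF that] in auto)
  qed simp
qed

text \<open>Here \<open>P\<close> preserves the square sum of the functionals, so the loss bound
  holds for every value of \<open>r n\<close>, including those near 1.\<close>

lemma not_synchronizes_if_periodic:
  assumes nontriv: "prob {\<omega>\<in>space M. Z 0 \<omega> = 0} + prob {\<omega>\<in>space M. Z 0 \<omega> = 1} < 1"
    and "mat_period P \<ge> 2" and sum: "summable (\<lambda>n. r n * (1 - r n))"
  shows "\<not> ae_synchronizes M Z"
proof -
  define d where "d = mat_period P"
  obtain f :: "nat \<Rightarrow> real ^ 'n \<Rightarrow> real" where f: "\<And>a. linear (f a)" "\<And>a. a < d \<Longrightarrow> f a 1 = 0"
    "\<And>x. (\<Sum>a<d. (f a (P *v x))\<^sup>2) = (\<Sum>a<d. (f a x)\<^sup>2)" "\<And>l. (\<Sum>a<d. (f a (axis l 1))\<^sup>2) > 0"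
    using periodic_functionals[OF d_def] assms(2) unfolding d_def by blast
  show ?thesis
  proof (rule not_synchronizes[OF nontriv sum _ f(1) _ f(4)])
    show "(1 - 4 * (r n * (1 - r n))) * (\<Sum>a<d. (f a x)\<^sup>2) \<le> (\<Sum>a<d. (f a (drift (r n) x))\<^sup>2)" for n x
      using r_bounds'[of n] f by (intro sum_squares_drift_ge) auto
  qed (use f(2) in auto)
qed

end

theorem corollary2p5:
  fixes M :: "'a measure"
    and W :: "real ^ 'n ^ 'n"
    and r :: "nat \<Rightarrow> real"
    and Z X :: "nat \<Rightarrow> 'a \<Rightarrow> real ^ 'n"
  assumes "prob_space M"
    and "CARD('n) \<ge> 2"
    and "\<forall>i j. W $ i $ j \<ge> 0"
    and "irreducible_mat W"
    and "transpose W *v 1 = 1"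
    and "\<forall>n. 0 < r n \<and> r n < 1"
    and "Z 0 \<in> borel_measurable M"
    and "\<forall>\<omega>\<in>space M. \<forall>l. Z 0 \<omega> $ l \<in> {0..1}"
    and "measure M {\<omega>\<in>space M. Z 0 \<omega> = 0} + measure M {\<omega>\<in>space M. Z 0 \<omega> = 1} < 1"
    and "\<forall>n\<ge>1. X n \<in> borel_measurable M"
    and "\<forall>n\<ge>1. \<forall>\<omega>\<in>space M. \<forall>l. X n \<omega> $ l \<in> {0, 1}"
    and "\<forall>n. cond_indep_vars M (history M (Z 0) X n) (\<lambda>_. borel) (\<lambda>l \<omega>. X (Suc n) \<omega> $ l) UNIV"
    and "\<forall>n l. AE \<omega> in M.
           cond_prob_sigma M (history M (Z 0) X n) {\<omega>'\<in>space M. X (Suc n) \<omega>' $ l = 1} \<omega> =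
           (transpose W *v Z n \<omega>) $ l"
    and "\<forall>n. \<forall>\<omega>\<in>space M. Z (Suc n) \<omega> = (1 - r n) *\<^sub>R Z n \<omega> + r n *\<^sub>R X (Suc n) \<omega>"
  shows "(mat_period (transpose W) = 1 \<longrightarrow>
            (ae_synchronizes M Z \<longleftrightarrow>
             filterlim (\<lambda>n. \<Sum>k<n. r k) at_top sequentially)) \<and>
         (mat_period (transpose W) \<ge> 2 \<longrightarrow>
            (ae_synchronizes M Z \<longleftrightarrow>
             filterlim (\<lambda>n. \<Sum>k<n. r k * (1 - r k)) at_top sequentially))"
proof -
  have nn: "transpose W $ i $ j \<ge> 0" for i j using assms(3) by (simp add: transpose_def)
  have irr: "irreducible_mat (transpose W)" using assms(4) by (simp add: irreducible_mat_transpose)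
  obtain \<pi> where \<pi>: "\<And>i. \<pi> $ i > 0" "(\<Sum>i\<in>UNIV. \<pi> $ i) = 1" "\<pi> v* transpose W = \<pi>"
    using ex_stationary_distribution[OF nn irr assms(5)] by blast
  interpret reinforced_process "transpose W" \<pi> M r Z X
    using assms nn irr \<pi>
    by (intro reinforced_process.intro irreducible_chain.intro reinforced_process_axioms.intro) auto
  have r1: "filterlim (\<lambda>n. \<Sum>k<n. r k) at_top sequentially \<longleftrightarrow> \<not> summable r"
    using r_bounds' by (intro filterlim_sum_at_top_iff) auto
  have r2: "filterlim (\<lambda>n. \<Sum>k<n. r k * (1 - r k)) at_top sequentially \<longleftrightarrow> \<not> summable (\<lambda>n. r n * (1 - r n))"
    using r_bounds' by (intro filterlim_sum_at_top_iff) auto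
  \<comment> \<open>Period 1 pairs \<open>synchronizes_if_aperiodic\<close> with the variance
    obstruction; period at least 2 pairs \<open>synchronizes_if_divergent\<close> with the cyclic
    obstruction.\<close>
  show ?thesis
    unfolding r1 r2
    using synchronizes_if_aperiodic synchronizes_if_divergent
      not_synchronizes_if_summable[OF assms(9,2)] not_synchronizes_if_periodic[OF assms(9)]
    by blast
qed

end
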